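(* The \textsc{Constrained Layer Tree} problem with $n_0$ leaves and $\lambda$ layers can be solved in $\mathcal O\bigl(n_0^{2\lambda+2}\cdot\lambda^2\cdot\log n_0\bigr)$ time.
   Context: A layer tree with layers $0,\dots,\lambda$ is a rooted tree whose leaves are in layer $0$, with exactly one root in layer $\lambda$, every edge going from a vertex in layer $i-1$ to its parent in layer $i$. The weight $w(v)$ of a vertex is the number of leaves in its subtree. An instance of \textsc{Constrained Layer Tree} consists of a complete layered graph with $n_i$ vertices in layer $i$ for $i\in\{0,\dots,\lambda\}$ (all edges between consecutive layers present) together with lower and upper capacities $(\ell_i,u_i)$ for each $i\in\{1,\dots,\lambda\}$; it is determined by the numbers $n_0$ and $(n_i,\ell_i,u_i)_{i\in\{1,\dots,\lambda\}}$. It asks whether the graph contains as a subgraph a layer tree containing all $n_0$ vertices of layer $0$ as leaves such that every vertex $v$ of the tree in layer $i\ge1$ satisfies $\ell_i\le w(v)\le u_i$. *)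

theory Defs
  imports
    Complex_Main
    "HOL-Library.Landau_Symbols"
    "Graph_Theory.Graph_Theory"
begin

section \<open>Layer trees\<close>

text \<open>Edges of a rooted tree point from a vertex to its parent. Since every edge of a layer tree
  goes from some layer to the next one, orienting the layered graph upwards as well loses
  nothing.\<close>

definition rooted_tree :: "'v pair_pre_digraph \<Rightarrow> 'v \<Rightarrow> bool" where
  "rooted_tree T r \<longleftrightarrow>
     pair_fin_digraph T \<and>
     r \<in> pverts T \<and> out_degree (with_proj T) r = 0 \<and>
     (\<forall>v \<in> pverts T - {r}. out_degree (with_proj T) v = 1) \<and>
     (\<forall>v \<in> pverts T. v \<rightarrow>\<^sup>*\<^bsub>with_proj T\<^esub> r)"

definition leaves :: "'v pair_pre_digraph \<Rightarrow> 'v set" where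
  "leaves T = {v \<in> pverts T. in_degree (with_proj T) v = 0}"

definition weight :: "'v pair_pre_digraph \<Rightarrow> 'v \<Rightarrow> nat" where
  "weight T v = card {x \<in> leaves T. x \<rightarrow>\<^sup>*\<^bsub>with_proj T\<^esub> v}"

text \<open>The vertex \<open>(i, k)\<close> is the \<open>k\<close>-th vertex of layer \<open>i\<close>, counting from \<open>0\<close>.\<close>

type_synonym vertex = "nat \<times> nat"

abbreviation layer :: "vertex \<Rightarrow> nat" where
  "layer \<equiv> fst"

definition layer_tree :: "nat \<Rightarrow> vertex pair_pre_digraph \<Rightarrow> bool" where
  "layer_tree lam T \<longleftrightarrow>
     (\<exists>r. rooted_tree T r \<and> {v \<in> pverts T. layer v = lam} = {r}) \<and>
     (\<forall>v \<in> pverts T. layer v \<le> lam) \<and>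
     (\<forall>v \<in> leaves T. layer v = 0) \<and>
     (\<forall>(u, v) \<in> parcs T. layer v = layer u + 1)"

section \<open>Constrained Layer Tree\<close>

text \<open>Only \<open>layer_size I i\<close> for \<open>i \<le> num_layers I\<close> and the capacities for
  \<open>1 \<le> i \<le> num_layers I\<close> are meaningful. Both the problem and the encoding of an instance
  ignore all other values. The layers are \<open>0, \<dots>, num_layers I\<close>.\<close>

record clt_instance =
  num_layers :: nat
  layer_size :: "nat \<Rightarrow> nat"
  lower_cap :: "nat \<Rightarrow> nat"
  upper_cap :: "nat \<Rightarrow> nat"

definition complete_layered_graph :: "clt_instance \<Rightarrow> vertex pair_pre_digraph" where
  "complete_layered_graph I =
     \<lparr> pverts = {(i, k). i \<le> num_layers I \<and> k < layer_size I i},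
       parcs = {((i, k), (Suc i, k')) | i k k'.
                  i < num_layers I \<and> k < layer_size I i \<and> k' < layer_size I (Suc i)} \<rparr>"

definition constrained_layer_tree :: "clt_instance \<Rightarrow> bool" where
  "constrained_layer_tree I \<longleftrightarrow>
     (\<exists>T. subgraph (with_proj T) (with_proj (complete_layered_graph I)) \<and>
          layer_tree (num_layers I) T \<and>
          {v \<in> pverts (complete_layered_graph I). layer v = 0} \<subseteq> leaves T \<and>
          (\<forall>v \<in> pverts T. layer v \<ge> 1 \<longrightarrow>
             lower_cap I (layer v) \<le> weight T v \<and> weight T v \<le> upper_cap I (layer v)))"

definition encode :: "clt_instance \<Rightarrow> nat list" where
  "encode I = num_layers I # layer_size I 0 #
     concat (map (\<lambda>i. [layer_size I i, lower_cap I i, upper_cap I i]) [1..<Suc (num_layers I)])"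

section \<open>Unit-cost random access machines\<close>

text \<open>Running times refer to the unit-cost random access machine of Cook and Reckhow: one step per
  instruction, with addition and subtraction as the only arithmetic. In particular there is no
  multiplication, so the length of the numbers grows by at most one bit per step. Subtraction is
  truncated at \<open>0\<close>, as cells hold natural numbers. A program uses only the finitely many registers
  that it names; the memory is addressed through registers.\<close>

datatype instr =
    Const nat nat
  | Add nat nat nat
  | Sub nat nat nat
  | Load nat nat
  | Store nat nat
  | Jump nat
  | JumpPos nat nat

record ram_config =
  pc :: nat
  reg :: "nat \<Rightarrow> nat"
  mem :: "nat \<Rightarrow> nat"

fun exec :: "instr \<Rightarrow> ram_config \<Rightarrow> ram_config" where
  "exec (Const d k) s = s\<lparr>pc := pc s + 1, reg := (reg s)(d := k)\<rparr>"
| "exec (Add d a b) s = s\<lparr>pc := pc s + 1, reg := (reg s)(d := reg s a + reg s b)\<rparr>"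
| "exec (Sub d a b) s = s\<lparr>pc := pc s + 1, reg := (reg s)(d := reg s a - reg s b)\<rparr>"
| "exec (Load d a) s = s\<lparr>pc := pc s + 1, reg := (reg s)(d := mem s (reg s a))\<rparr>"
| "exec (Store a b) s = s\<lparr>pc := pc s + 1, mem := (mem s)(reg s a := reg s b)\<rparr>"
| "exec (Jump l) s = s\<lparr>pc := l\<rparr>"
| "exec (JumpPos a l) s = s\<lparr>pc := (if reg s a > 0 then l else pc s + 1)\<rparr>"

definition halted :: "instr list \<Rightarrow> ram_config \<Rightarrow> bool" where
  "halted P s \<longleftrightarrow> length P \<le> pc s"

definition ram_step :: "instr list \<Rightarrow> ram_config \<Rightarrow> ram_config" where
  "ram_step P s = (if halted P s then s else exec (P ! pc s) s)"

definition init_config :: "nat list \<Rightarrow> ram_config" where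
  "init_config xs =
     \<lparr> pc = 0, reg = (\<lambda>_. 0), mem = (\<lambda>a. if a < length xs then xs ! a else 0) \<rparr>"

definition config_after :: "instr list \<Rightarrow> nat list \<Rightarrow> nat \<Rightarrow> ram_config" where
  "config_after P xs t = (ram_step P ^^ t) (init_config xs)"

definition halts :: "instr list \<Rightarrow> nat list \<Rightarrow> bool" where
  "halts P xs \<longleftrightarrow> (\<exists>t. halted P (config_after P xs t))"

text \<open>The running time and the output are meaningful only if the program halts.\<close>

definition running_time :: "instr list \<Rightarrow> nat list \<Rightarrow> nat" where
  "running_time P xs = (LEAST t. halted P (config_after P xs t))"

definition ram_output :: "instr list \<Rightarrow> nat list \<Rightarrow> nat" where
  "ram_output P xs = reg (config_after P xs (running_time P xs)) 0"

definition solves_clt :: "instr list \<Rightarrow> bool" where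
  "solves_clt P \<longleftrightarrow>
     (\<forall>I. halts P (encode I) \<and>
          ram_output P (encode I) = (if constrained_layer_tree I then 1 else 0))"

end

theory Submission
  imports Defs
begin

text \<open>Order the leaves such that the leaves below every vertex are consecutive. A layer tree is then built
  by a scan of the leaves from left to right: before the next leaf is placed, the current vertices of the layers
  \<open>0, \<dots>, h\<close> are completed, for some \<open>h\<close>. What can follow depends only on the position and, for
  each layer \<open>1, \<dots>, \<lambda>\<close>, on the first leaf of the current vertex and the number of completed vertices,
  so there are at most \<open>n\<^sub>0\<^sup>2\<^sup>\<lambda>\<close> states at each of the \<open>n\<^sub>0\<close> positions. A table of marks, indexed by
  the states as numbers in base \<open>n\<^sub>0\<close>, is filled position by position. Decoding a state by
  repeated subtraction and marking its successors, one for each \<open>h\<close>, takes \<open>O(n\<^sub>0 \<lambda>)\<close> steps, and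
  \<open>O(n\<^sub>0\<^sup>2\<^sup>\<lambda>\<^sup>+\<^sup>2 \<lambda>)\<close> steps suffice in total.\<close>

section \<open>Structured programs\<close>

text \<open>In a complete layered graph the vertices of a layer are interchangeable. A solution is
  therefore a chain of ever coarser partitions of the leaves, of which only the block sizes and the
  number of blocks per layer matter; this is why the leaves may be reordered at will. In sorted
  order a coarser partition can change its block only where the finer one does, so the layers that
  change before a given leaf form an initial segment, and the single number \<open>h\<close>
  describes the step. When a block ends, its first leaf gives its size and the count decides whether
  the layer still has room: two numbers per layer, both below the position and hence digits in base
  \<open>n\<close>. The machine cannot multiply, so the powers of \<open>n\<close> are tabulated
  once, and each product or quotient by such a power takes at most \<open>n\<close> additions or
  subtractions. Every position has its own row of marks in memory that is zero at the start, so
  nothing is ever cleared.\<close>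

datatype com =
    Block "instr list"
  | Seq com com
  | Cond nat com com
  | Loop nat com

fun csize :: "com \<Rightarrow> nat" where
  "csize (Block is) = length is"
| "csize (Seq c d) = csize c + csize d"
| "csize (Cond a c d) = csize c + csize d + 2"
| "csize (Loop a c) = csize c + 3"

text \<open>Jump targets of the machine are absolute, hence the load address as an argument.
  \<open>JumpPos\<close> falls through on zero, so the zero branch of a conditional comes first in
  the code.\<close>

fun compile :: "nat \<Rightarrow> com \<Rightarrow> instr list" where
  "compile l (Block is) = is"
| "compile l (Seq c d) = compile l c @ compile (l + csize c) d"
| "compile l (Cond a c d) =
     [JumpPos a (l + csize d + 2)] @ compile (l + 1) d @ [Jump (l + csize d + 2 + csize c)]
       @ compile (l + csize d + 2) c"
| "compile l (Loop a c) =
     [JumpPos a (l + 2), Jump (l + csize c + 3)] @ compile (l + 2) c @ [Jump l]"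

lemma length_compile [simp]: "length (compile l c) = csize c"
  by (induction c arbitrary: l) auto

section \<open>Correctness of compiled code with a time bound\<close>

primrec code_at :: "instr list \<Rightarrow> nat \<Rightarrow> instr list \<Rightarrow> bool" where
  "code_at P l [] \<longleftrightarrow> True"
| "code_at P l (x # xs) \<longleftrightarrow> l < length P \<and> P ! l = x \<and> code_at P (Suc l) xs"

lemma code_at_append [simp]:
  "code_at P l (xs @ ys) \<longleftrightarrow> code_at P l xs \<and> code_at P (l + length xs) ys"
  by (induction xs arbitrary: l) auto

lemma code_at_self: "code_at P 0 P"
proof -
  have "code_at (pre @ xs) (length pre) xs" for pre xs :: "instr list"
    by (induction xs arbitrary: pre) (simp_all, metis append.assoc append_Cons append_Nil length_append_singleton)
  from this[of "[]" P] show ?thesis by simp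
qed

lemma ram_step_code_at:
  "code_at P l (x # xs) \<Longrightarrow> ram_step P \<lparr>pc = l, reg = R, mem = M\<rparr> = exec x \<lparr>pc = l, reg = R, mem = M\<rparr>"
  by (simp add: ram_step_def halted_def)

lemma funpow_one: "(f ^^ 1) x = f x" for f :: "'a \<Rightarrow> 'a"
  by simp

text \<open>The time and the final state are chosen before the surrounding program and the load
  address, so they do not depend on where the code sits. \<open>Q\<close> may itself be an
  \<open>ach\<close> statement about the code that follows.\<close>

definition ach ::
  "com \<Rightarrow> (nat \<Rightarrow> nat) \<Rightarrow> (nat \<Rightarrow> nat) \<Rightarrow> nat \<Rightarrow> ((nat \<Rightarrow> nat) \<Rightarrow> (nat \<Rightarrow> nat) \<Rightarrow> bool) \<Rightarrow> bool" where
  "ach c R M T Q \<longleftrightarrow> (\<exists>t R' M'. t \<le> T \<and> Q R' M' \<and>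
     (\<forall>P l. code_at P l (compile l c) \<longrightarrow>
        (ram_step P ^^ t) \<lparr>pc = l, reg = R, mem = M\<rparr> = \<lparr>pc = l + csize c, reg = R', mem = M'\<rparr>))"

lemma ach_mono:
  assumes "ach c R M T Q" "T \<le> T'" "\<And>R' M'. Q R' M' \<Longrightarrow> Q' R' M'"
  shows "ach c R M T' Q'"
  using assms unfolding ach_def by (meson order_trans)

text \<open>Jumps do not occur in blocks, hence the value \<^const>\<open>False\<close>.\<close>

fun blk ::
  "instr list \<Rightarrow> (nat \<Rightarrow> nat) \<Rightarrow> (nat \<Rightarrow> nat) \<Rightarrow> ((nat \<Rightarrow> nat) \<Rightarrow> (nat \<Rightarrow> nat) \<Rightarrow> bool) \<Rightarrow> bool" where
  "blk [] R M Q = Q R M"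
| "blk (Const d k # is) R M Q = blk is (R(d := k)) M Q"
| "blk (Add d a b # is) R M Q = blk is (R(d := R a + R b)) M Q"
| "blk (Sub d a b # is) R M Q = blk is (R(d := R a - R b)) M Q"
| "blk (Load d a # is) R M Q = blk is (R(d := M (R a))) M Q"
| "blk (Store a b # is) R M Q = blk is R (M(R a := R b)) Q"
| "blk (Jump l # is) R M Q = False"
| "blk (JumpPos a l # is) R M Q = False"

lemma ach_Block:
  assumes "blk is R M Q" "length is \<le> T"
  shows "ach (Block is) R M T Q"
proof -
  have "\<exists>R' M'. Q R' M' \<and> (\<forall>P l. code_at P l is \<longrightarrow>
      (ram_step P ^^ length is) \<lparr>pc = l, reg = R, mem = M\<rparr> = \<lparr>pc = l + length is, reg = R', mem = M'\<rparr>)"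
    using assms(1)
  proof (induction "is" R M Q rule: blk.induct)
    case (1 R M Q) then show ?case by auto
  next
    case (2 d k "is" R M Q)
    then show ?case
      by (fastforce simp: funpow_Suc_right ram_step_code_at simp del: funpow.simps)
  next
    case (3 d a b "is" R M Q)
    then show ?case
      by (fastforce simp: funpow_Suc_right ram_step_code_at simp del: funpow.simps)
  next
    case (4 d a b "is" R M Q)
    then show ?case
      by (fastforce simp: funpow_Suc_right ram_step_code_at simp del: funpow.simps)
  next
    case (5 d a "is" R M Q)
    then show ?case
      by (fastforce simp: funpow_Suc_right ram_step_code_at simp del: funpow.simps)
  next
    case (6 a b "is" R M Q)
    then show ?case
      by (fastforce simp: funpow_Suc_right ram_step_code_at simp del: funpow.simps)
  qed auto
  then show ?thesis
    using assms(2) unfolding ach_def by fastforce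
qed

lemma ach_Seq:
  assumes "ach c R M Tc (\<lambda>R' M'. ach d R' M' Td Q)" "Tc + Td \<le> T"
  shows "ach (Seq c d) R M T Q"
proof -
  obtain t1 R1 M1 where 1: "t1 \<le> Tc" "ach d R1 M1 Td Q"
    "\<And>P l. code_at P l (compile l c) \<Longrightarrow>
        (ram_step P ^^ t1) \<lparr>pc = l, reg = R, mem = M\<rparr> = \<lparr>pc = l + csize c, reg = R1, mem = M1\<rparr>"
    using assms(1) unfolding ach_def by blast
  obtain t2 R2 M2 where 2: "t2 \<le> Td" "Q R2 M2"
    "\<And>P l. code_at P l (compile l d) \<Longrightarrow>
        (ram_step P ^^ t2) \<lparr>pc = l, reg = R1, mem = M1\<rparr> = \<lparr>pc = l + csize d, reg = R2, mem = M2\<rparr>"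
    using 1(2) unfolding ach_def by blast
  have "(ram_step P ^^ (t2 + t1)) \<lparr>pc = l, reg = R, mem = M\<rparr>
      = \<lparr>pc = l + csize (Seq c d), reg = R2, mem = M2\<rparr>"
    if "code_at P l (compile l (Seq c d))" for P l
    using that 1(3)[of P l] 2(3)[of P "l + csize c"] by (simp add: funpow_add add.assoc)
  moreover have "t2 + t1 \<le> T" using 1(1) 2(1) assms(2) by simp
  ultimately show ?thesis using 2(2) unfolding ach_def by blast
qed

text \<open>The positive branch pays for the test only; the zero branch also pays for the jump over
  the other branch, hence the 2.\<close>

lemma ach_Cond:
  assumes "R a > 0 \<Longrightarrow> ach c R M Tc Q" "R a = 0 \<Longrightarrow> ach d R M Tc Q" "Tc + 2 \<le> T"
  shows "ach (Cond a c d) R M T Q"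
proof (cases "R a > 0")
  case True
  then obtain t R' M' where 1: "t \<le> Tc" "Q R' M'"
    "\<And>P l. code_at P l (compile l c) \<Longrightarrow>
        (ram_step P ^^ t) \<lparr>pc = l, reg = R, mem = M\<rparr> = \<lparr>pc = l + csize c, reg = R', mem = M'\<rparr>"
    using assms(1) unfolding ach_def by blast
  have "(ram_step P ^^ (t + 1)) \<lparr>pc = l, reg = R, mem = M\<rparr>
      = \<lparr>pc = l + csize (Cond a c d), reg = R', mem = M'\<rparr>"
    if "code_at P l (compile l (Cond a c d))" for P l
  proof -
    have "ram_step P \<lparr>pc = l, reg = R, mem = M\<rparr> = \<lparr>pc = l + csize d + 2, reg = R, mem = M\<rparr>"
      using that True by (simp add: ram_step_def halted_def)
    moreover have "(ram_step P ^^ t) \<lparr>pc = l + csize d + 2, reg = R, mem = M\<rparr>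
        = \<lparr>pc = l + csize (Cond a c d), reg = R', mem = M'\<rparr>"
      using that 1(3)[of P "l + csize d + 2"] by (simp add: algebra_simps)
    ultimately show ?thesis by (simp only: funpow_add o_apply funpow_one)
  qed
  then show ?thesis using 1(1,2) assms(3) unfolding ach_def
    by (intro exI[of _ "t + 1"] exI[of _ R'] exI[of _ M']) auto
next
  case False
  then obtain t R' M' where 1: "t \<le> Tc" "Q R' M'"
    "\<And>P l. code_at P l (compile l d) \<Longrightarrow>
        (ram_step P ^^ t) \<lparr>pc = l, reg = R, mem = M\<rparr> = \<lparr>pc = l + csize d, reg = R', mem = M'\<rparr>"
    using assms(2) unfolding ach_def by blast
  have "(ram_step P ^^ (1 + (t + 1))) \<lparr>pc = l, reg = R, mem = M\<rparr>
      = \<lparr>pc = l + csize (Cond a c d), reg = R', mem = M'\<rparr>"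
    if "code_at P l (compile l (Cond a c d))" for P l
  proof -
    have "ram_step P \<lparr>pc = l, reg = R, mem = M\<rparr> = \<lparr>pc = l + 1, reg = R, mem = M\<rparr>"
      using that False by (simp add: ram_step_def halted_def)
    moreover have "(ram_step P ^^ t) \<lparr>pc = l + 1, reg = R, mem = M\<rparr>
        = \<lparr>pc = l + 1 + csize d, reg = R', mem = M'\<rparr>"
      using that 1(3)[of P "l + 1"] by simp
    moreover have "ram_step P \<lparr>pc = l + 1 + csize d, reg = R', mem = M'\<rparr>
        = \<lparr>pc = l + csize (Cond a c d), reg = R', mem = M'\<rparr>"
      using that by (simp add: ram_step_def halted_def algebra_simps)
    ultimately show ?thesis by (simp only: funpow_add o_apply funpow_one)
  qed
  then show ?thesis using 1(1,2) assms(3) unfolding ach_def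
    by (intro exI[of _ "1 + (t + 1)"] exI[of _ R'] exI[of _ M']) auto
qed

text \<open>The measure \<open>f\<close> drops in every pass, so it bounds the number of passes as
  well as ensuring termination. A pass pays for the test and the jump back, leaving the loop for the
  test and the exit jump.\<close>

lemma ach_Loop:
  assumes "I R M"
    and step: "\<And>R M. I R M \<Longrightarrow> R a > 0 \<Longrightarrow> ach c R M Tb (\<lambda>R' M'. I R' M' \<and> f R' < f R)"
    and "f R * (Tb + 2) + 2 \<le> T"
    and final: "\<And>R M. I R M \<Longrightarrow> R a = 0 \<Longrightarrow> Q R M"
  shows "ach (Loop a c) R M T Q"
  using assms(1,3)
proof (induction "f R" arbitrary: R M T rule: less_induct)
  case less
  show ?case
  proof (cases "R a > 0")
    case False
    have "(ram_step P ^^ 2) \<lparr>pc = l, reg = R, mem = M\<rparr>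
        = \<lparr>pc = l + csize (Loop a c), reg = R, mem = M\<rparr>"
      if "code_at P l (compile l (Loop a c))" for P l
      using that False by (simp add: ram_step_def halted_def numeral_2_eq_2)
    moreover have "Q R M" using final less.prems False by simp
    ultimately show ?thesis using less.prems(2) unfolding ach_def
      by (intro exI[of _ 2] exI[of _ R] exI[of _ M]) auto
  next
    case True
    obtain t1 R1 M1 where 1: "t1 \<le> Tb" "I R1 M1" "f R1 < f R"
      "\<And>P l. code_at P l (compile l c) \<Longrightarrow>
          (ram_step P ^^ t1) \<lparr>pc = l, reg = R, mem = M\<rparr> = \<lparr>pc = l + csize c, reg = R1, mem = M1\<rparr>"
      using step[OF less.prems(1) True] unfolding ach_def by blast
    obtain t2 R2 M2 where 2: "t2 \<le> f R1 * (Tb + 2) + 2" "Q R2 M2"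
      "\<And>P l. code_at P l (compile l (Loop a c)) \<Longrightarrow>
          (ram_step P ^^ t2) \<lparr>pc = l, reg = R1, mem = M1\<rparr>
            = \<lparr>pc = l + csize (Loop a c), reg = R2, mem = M2\<rparr>"
      using less.hyps[OF 1(3,2) order_refl] unfolding ach_def by blast
    have run: "(ram_step P ^^ (t2 + (1 + (t1 + 1)))) \<lparr>pc = l, reg = R, mem = M\<rparr>
        = \<lparr>pc = l + csize (Loop a c), reg = R2, mem = M2\<rparr>"
      if "code_at P l (compile l (Loop a c))" for P l
    proof -
      have "ram_step P \<lparr>pc = l, reg = R, mem = M\<rparr> = \<lparr>pc = l + 2, reg = R, mem = M\<rparr>"
        using that True by (simp add: ram_step_def halted_def)
      moreover have "(ram_step P ^^ t1) \<lparr>pc = l + 2, reg = R, mem = M\<rparr>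
          = \<lparr>pc = l + 2 + csize c, reg = R1, mem = M1\<rparr>"
        using that 1(4)[of P "l + 2"] by simp
      moreover have "ram_step P \<lparr>pc = l + 2 + csize c, reg = R1, mem = M1\<rparr>
          = \<lparr>pc = l, reg = R1, mem = M1\<rparr>"
        using that by (simp add: ram_step_def halted_def)
      ultimately show ?thesis using 2(3)[OF that] by (simp only: funpow_add o_apply funpow_one)
    qed
    have "(f R1 + 1) * (Tb + 2) \<le> f R * (Tb + 2)"
      using 1(3) by (intro mult_right_mono) auto
    then have "t2 + (1 + (t1 + 1)) \<le> T"
      using 1(1) 2(1) less.prems(2) by (simp add: algebra_simps)
    then show ?thesis using run 2(2) unfolding ach_def
      by (intro exI[of _ "t2 + (1 + (t1 + 1))"] exI[of _ R2] exI[of _ M2]) auto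
  qed
qed

text \<open>A halted configuration is a fixed point of \<open>ram_step\<close>, so the output at the
  first halting time agrees with the one at the time supplied by \<open>ach\<close>.\<close>

lemma ach_program:
  assumes "ach c (\<lambda>_. 0) (mem (init_config xs)) T (\<lambda>R M. R 0 = v)"
  shows "halts (compile 0 c) xs" "running_time (compile 0 c) xs \<le> T" "ram_output (compile 0 c) xs = v"
proof -
  let ?P = "compile 0 c"
  obtain t R M where t: "t \<le> T" "R 0 = v"
    "\<And>P l. code_at P l (compile l c) \<Longrightarrow> (ram_step P ^^ t) \<lparr>pc = l, reg = \<lambda>_. 0, mem = mem (init_config xs)\<rparr>
       = \<lparr>pc = l + csize c, reg = R, mem = M\<rparr>"
    using assms unfolding ach_def by blast
  have fin: "config_after ?P xs t = \<lparr>pc = csize c, reg = R, mem = M\<rparr>"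
    using t(3)[OF code_at_self] by (simp add: config_after_def init_config_def)
  then have halt: "halted ?P (config_after ?P xs t)"
    by (simp add: halted_def)
  then show "halts ?P xs" unfolding halts_def by blast
  have le: "running_time ?P xs \<le> t"
    unfolding running_time_def using halt by (rule Least_le)
  then show "running_time ?P xs \<le> T" using t(1) by simp
  have h: "halted ?P (config_after ?P xs (running_time ?P xs))"
    unfolding running_time_def using halt by (rule LeastI)
  have stay: "(ram_step P ^^ k) s = s" if "halted P s" for k P s
    using that by (induction k) (auto simp: ram_step_def)
  have "config_after ?P xs t
      = (ram_step ?P ^^ (t - running_time ?P xs)) (config_after ?P xs (running_time ?P xs))"
    using le unfolding config_after_def by (metis comp_apply funpow_add le_add_diff_inverse2)
  then have "config_after ?P xs t = config_after ?P xs (running_time ?P xs)"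
    using stay[OF h] by simp
  then show "ram_output ?P xs = v"
    using fin t(2) unfolding ram_output_def by (metis ram_config.select_convs(2))
qed

section \<open>Layer trees along a line of leaves\<close>

text \<open>Sending \<open>f x\<close> to \<open>g x\<close> is well defined and injective, because
  both functions have the same fibres on \<open>A\<close>.\<close>

lemma card_image_eq_if_same_kernel:
  assumes "\<And>x y. x \<in> A \<Longrightarrow> y \<in> A \<Longrightarrow> f x = f y \<longleftrightarrow> g x = g y"
  shows "card (f ` A) = card (g ` A)"
proof -
  have h: "g (inv_into A f (f x)) = g x" if "x \<in> A" for x
    using that assms[of "inv_into A f (f x)" x] by (simp add: inv_into_into f_inv_into_f)
  have "g ` A = (\<lambda>k. g (inv_into A f k)) ` f ` A"
    unfolding image_image using h by (intro image_cong) simp_all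
  moreover have "inj_on (\<lambda>k. g (inv_into A f k)) (f ` A)"
    by (rule inj_onI) (use h assms in auto)
  ultimately show ?thesis by (simp add: card_image)
qed

locale layers =
  fixes n lam :: nat and N L U :: "nat \<Rightarrow> nat"
begin

text \<open>\<open>g i x\<close> is the index of the ancestor in layer \<open>i\<close> of leaf \<open>x\<close>.\<close>

definition layering :: "(nat \<Rightarrow> nat \<Rightarrow> nat) \<Rightarrow> bool" where
  "layering g \<longleftrightarrow> n \<ge> 1 \<and> (\<forall>x<n. g 0 x = x) \<and>
     (\<forall>i<lam. \<forall>x<n. \<forall>y<n. g i x = g i y \<longrightarrow> g (Suc i) x = g (Suc i) y) \<and>
     (\<forall>x<n. \<forall>y<n. g lam x = g lam y) \<and>
     (\<forall>i\<in>{1..lam}. \<forall>x<n. g i x < N i \<and>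
        L i \<le> card {y. y < n \<and> g i y = g i x} \<and> card {y. y < n \<and> g i y = g i x} \<le> U i)"

text \<open>A scan of the leaves from left to right that has placed the leaves \<open>0, \<dots>, p - 1\<close>:
  in layer \<open>i\<close>, the current vertex has the leaves \<open>b i, \<dots>, p - 1\<close> so far,
  and \<open>c i\<close> vertices are complete. The step completes the current vertices of the layers
  \<open>0, \<dots>, h\<close> and places the leaf \<open>p\<close>.\<close>

definition complete_ok :: "nat \<Rightarrow> (nat \<Rightarrow> nat) \<Rightarrow> (nat \<Rightarrow> nat) \<Rightarrow> nat \<Rightarrow> bool" where
  "complete_ok p b c i \<longleftrightarrow> L i \<le> p - b i \<and> p - b i \<le> U i \<and> c i < N i"

definition next_start :: "nat \<Rightarrow> nat \<Rightarrow> (nat \<Rightarrow> nat) \<Rightarrow> nat \<Rightarrow> nat" where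
  "next_start h p b i = (if i \<le> h then p else b i)"

definition next_count :: "nat \<Rightarrow> (nat \<Rightarrow> nat) \<Rightarrow> nat \<Rightarrow> nat" where
  "next_count h c i = (if i \<le> h then c i + 1 else c i)"

inductive reach :: "nat \<Rightarrow> (nat \<Rightarrow> nat) \<Rightarrow> (nat \<Rightarrow> nat) \<Rightarrow> bool" where
  init: "reach 1 (\<lambda>_. 0) (\<lambda>_. 0)"
| step: "reach p b c \<Longrightarrow> h \<le> lam \<Longrightarrow> \<forall>i\<in>{1..h}. complete_ok p b c i \<Longrightarrow>
    reach (Suc p) (next_start h p b) (next_count h c)"

definition accepting :: "nat \<Rightarrow> (nat \<Rightarrow> nat) \<Rightarrow> (nat \<Rightarrow> nat) \<Rightarrow> bool" where
  "accepting p b c \<longleftrightarrow> (\<forall>i\<in>{1..lam}. complete_ok p b c i) \<and> b lam = 0"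

section \<open>Soundness: an accepting scan yields a layering\<close>

lemma reach_bounds: "reach p b c \<Longrightarrow> p \<ge> 1 \<and> (\<forall>i. b i < p \<and> c i < p)"
  by (induction rule: reach.induct) (auto simp: next_start_def next_count_def intro: less_SucI)

text \<open>Vertices in layer 0 are single leaves, and layers above \<open>lam\<close> never change.
  Outside the layers \<open>1, ..., lam\<close> the state is thus a function of \<open>p\<close> and
  need not be stored.\<close>

lemma reach_outside: "reach p b c \<Longrightarrow> b 0 = p - 1 \<and> c 0 = p - 1 \<and> (\<forall>i>lam. b i = 0 \<and> c i = 0)"
proof (induction rule: reach.induct)
  case (step p b c h)
  then show ?case using reach_bounds[OF step.hyps(1)]
    by (auto simp: next_start_def next_count_def)
qed simp

text \<open>The vertices of a layer are numbered in the order in which the scan opens them: the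
  current one has index \<open>c i\<close>, the completed ones have the smaller indices.\<close>

definition scanned :: "nat \<Rightarrow> (nat \<Rightarrow> nat) \<Rightarrow> (nat \<Rightarrow> nat) \<Rightarrow> (nat \<Rightarrow> nat \<Rightarrow> nat) \<Rightarrow> bool" where
  "scanned p b c g \<longleftrightarrow> (\<forall>x<p. g 0 x = x) \<and>
     (\<forall>i. \<forall>x<p. \<forall>y<p. g i x = g i y \<longrightarrow> g (Suc i) x = g (Suc i) y) \<and>
     (\<forall>i. \<forall>x<p. g i x \<le> c i) \<and>
     (\<forall>i. {x. x < p \<and> g i x = c i} = {b i..<p}) \<and>
     (\<forall>i\<ge>1. \<forall>k<c i. L i \<le> card {x. x < p \<and> g i x = k} \<and> card {x. x < p \<and> g i x = k} \<le> U i)"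

text \<open>The new leaf opens a fresh vertex in the layers up to \<open>h\<close> and joins the
  current vertex in all higher ones; older leaves keep their ancestors.\<close>

lemma reach_scanned: "reach p b c \<Longrightarrow> \<exists>g. scanned p b c g"
proof (induction rule: reach.induct)
  case init
  show ?case
    by (rule exI[of _ "\<lambda>_ _. 0"]) (auto simp: scanned_def)
next
  case (step p b c h)
  from step.IH obtain g where g: "scanned p b c g" ..
  have g0: "\<And>x. x < p \<Longrightarrow> g 0 x = x" and
    coh: "\<And>i x y. x < p \<Longrightarrow> y < p \<Longrightarrow> g i x = g i y \<Longrightarrow> g (Suc i) x = g (Suc i) y" and
    le: "\<And>i x. x < p \<Longrightarrow> g i x \<le> c i" and
    cur: "\<And>i. {x. x < p \<and> g i x = c i} = {b i..<p}" and
    siz: "\<And>i k. i \<ge> 1 \<Longrightarrow> k < c i \<Longrightarrow>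
       L i \<le> card {x. x < p \<and> g i x = k} \<and> card {x. x < p \<and> g i x = k} \<le> U i"
    using g unfolding scanned_def by blast+
  note bnd = reach_bounds[OF step.hyps(1)] and out = reach_outside[OF step.hyps(1)]
  define c' where "c' = next_count h c"
  define b' where "b' = next_start h p b"
  define g' where "g' i x = (if x = p then c' i else g i x)" for i x
  have last: "g i (p - 1) = c i" for i
  proof -
    have "b i < p" "1 \<le> p" using bnd by auto
    then have "p - 1 \<in> {b i..<p}" by auto
    then show ?thesis using cur[of i] by blast
  qed
  have inner: "x < p \<Longrightarrow> g' i x = g i x" and new: "g' i p = c' i" for i x
    by (auto simp: g'_def)
  have c'gt: "x < p \<Longrightarrow> g i x = c' i \<Longrightarrow> i > h \<and> g i x = c i" for i x
    using le[of x i] by (auto simp: c'_def next_count_def split: if_splits)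
  \<comment> \<open>An older leaf shares a vertex with leaf \<open>p\<close> only in a layer above
    \<open>h\<close>, where the current vertex goes on. The next layer is then above
    \<open>h\<close> too, and leaf \<open>p - 1\<close>, which is current everywhere, shows that the
    parent is the current vertex there.\<close>
  have tie: "g' (Suc i) x = g' (Suc i) p" if "x < p" "g' i x = g' i p" for i x
  proof -
    have "i > h" "g i x = c i" using c'gt that by (simp_all add: g'_def)
    moreover from this have "g (Suc i) x = g (Suc i) (p - 1)"
      using coh[of x "p - 1" i] that(1) last[of i] bnd by simp
    ultimately show ?thesis using that(1) last[of "Suc i"]
      by (simp add: g'_def c'_def next_count_def)
  qed
  have "scanned (Suc p) b' c' g'"
    unfolding scanned_def
  proof (intro conjI allI impI)
    fix x assume "x < Suc p"
    then show "g' 0 x = x"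
      using g0 out bnd by (auto simp: g'_def c'_def next_count_def less_Suc_eq)
  next
    fix i x y assume "x < Suc p" "y < Suc p" "g' i x = g' i y"
    then show "g' (Suc i) x = g' (Suc i) y"
      using tie[of x i] tie[of y i] coh[of x y i] inner by (auto simp: less_Suc_eq)
  next
    fix i x assume "x < Suc p"
    then show "g' i x \<le> c' i"
      using le[of x i] by (auto simp: g'_def c'_def next_count_def less_Suc_eq)
  next
    fix i show "{x. x < Suc p \<and> g' i x = c' i} = {b' i..<Suc p}"
    proof (cases "i \<le> h")
      case True
      then have "x < p \<Longrightarrow> g' i x \<noteq> c' i" for x using c'gt[of x i] inner[of x i] by auto
      then have "{x. x < Suc p \<and> g' i x = c' i} = {p}"
        using new by (auto simp: less_Suc_eq)
      then show ?thesis using True by (auto simp: b'_def next_start_def)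
    next
      case False
      have "b i \<le> p" using bnd by (simp add: less_imp_le)
      have "{x. x < Suc p \<and> g' i x = c' i} = insert p {x. x < p \<and> g i x = c i}"
        using False by (auto simp: g'_def c'_def next_count_def less_Suc_eq)
      also have "\<dots> = {b' i..<Suc p}"
        unfolding cur using False \<open>b i \<le> p\<close> by (auto simp: b'_def next_start_def)
      finally show ?thesis .
    qed
  next
    fix i k assume i: "(1::nat) \<le> i" and k: "k < c' i"
    have eq: "{x. x < Suc p \<and> g' i x = k} = {x. x < p \<and> g i x = k}"
      using k by (auto simp: g'_def less_Suc_eq)
    have "L i \<le> card {x. x < p \<and> g i x = k} \<and> card {x. x < p \<and> g i x = k} \<le> U i"
    proof (cases "k < c i")
      case True then show ?thesis using siz i by blast
    next
      case False
      \<comment> \<open>This vertex is completed by the present step. Its leaves are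
        \<open>b i, ..., p - 1\<close>, so \<open>complete_ok\<close> has tested its exact
        weight.\<close>
      then have "i \<le> h" "k = c i"
        using k by (auto simp: c'_def next_count_def split: if_splits)
      then show ?thesis using step.hyps(3) i cur[of i]
        by (auto simp: complete_ok_def)
    qed
    then show "L i \<le> card {x. x < Suc p \<and> g' i x = k}" "card {x. x < Suc p \<and> g' i x = k} \<le> U i"
      by (simp_all add: eq)
  qed
  then show ?case unfolding b'_def c'_def by blast
qed

text \<open>Acceptance tests the vertices still open after the last leaf. All indices in layer
  \<open>i\<close> are at most \<open>c i\<close>, so \<open>c i < N i\<close> bounds them at once,
  and \<open>b lam = 0\<close> puts every leaf below one root.\<close>

lemma layering_if_accepting:
  assumes "reach n b c" "accepting n b c"
  shows "\<exists>g. layering g"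
proof -
  obtain g where g: "scanned n b c g" using reach_scanned[OF assms(1)] by blast
  have ok: "complete_ok n b c i" if "i \<in> {1..lam}" for i
    using assms(2) that by (auto simp: accepting_def)
  have b0: "b lam = 0" using assms(2) by (auto simp: accepting_def)
  have cur: "{x. x < n \<and> g i x = c i} = {b i..<n}" for i using g by (simp add: scanned_def)
  have top: "g lam x = c lam" if "x < n" for x
  proof -
    have "x \<in> {x. x < n \<and> g lam x = c lam}" unfolding cur b0 using that by simp
    then show ?thesis by simp
  qed
  have size: "g i x < N i \<and> L i \<le> card {y. y < n \<and> g i y = g i x} \<and>
      card {y. y < n \<and> g i y = g i x} \<le> U i" if i: "i \<in> {1..lam}" and x: "x < n" for i x
  proof -
    have le: "g i x \<le> c i" using g x by (simp add: scanned_def)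
    show ?thesis
    proof (cases "g i x = c i")
      case True
      then show ?thesis unfolding True cur using ok[OF i] by (simp add: complete_ok_def)
    next
      case False
      then have "g i x < c i" using le by simp
      then have "L i \<le> card {y. y < n \<and> g i y = g i x} \<and> card {y. y < n \<and> g i y = g i x} \<le> U i"
        using g i by (simp add: scanned_def)
      then show ?thesis using ok[OF i] \<open>g i x < c i\<close> by (simp add: complete_ok_def)
    qed
  qed
  have "layering g"
    unfolding layering_def
  proof (intro conjI)
    show "1 \<le> n" using reach_bounds[OF assms(1)] by simp
    show "\<forall>x<n. g 0 x = x" using g by (simp add: scanned_def)
    show "\<forall>i<lam. \<forall>x<n. \<forall>y<n. g i x = g i y \<longrightarrow> g (Suc i) x = g (Suc i) y"
      using g unfolding scanned_def by blast
  qed (use top size in auto)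
  then show ?thesis by blast
qed

section \<open>Completeness: sorted leaves drive an accepting scan\<close>

definition monotone_layering :: "(nat \<Rightarrow> nat \<Rightarrow> nat) \<Rightarrow> bool" where
  "monotone_layering G \<longleftrightarrow> n \<ge> 1 \<and> inj_on (G 0) {..<n} \<and>
     (\<forall>i\<le>lam. \<forall>x y. x \<le> y \<longrightarrow> y < n \<longrightarrow> G i x \<le> G i y) \<and>
     (\<forall>i<lam. \<forall>x<n. \<forall>y<n. G i x = G i y \<longrightarrow> G (Suc i) x = G (Suc i) y) \<and>
     (\<forall>x<n. \<forall>y<n. G lam x = G lam y) \<and>
     (\<forall>i\<in>{1..lam}. card (G i ` {..<n}) \<le> N i \<and> (\<forall>x<n.
        L i \<le> card {y. y < n \<and> G i y = G i x} \<and> card {y. y < n \<and> G i y = G i x} \<le> U i))"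

text \<open>Sorting the leaves by the indices of their ancestors, from the root down, makes the leaves
  below each vertex consecutive. The sequence of indices is read as a number in a large base
  \<open>B\<close>, so that passing to the parent is division by \<open>B\<close>.\<close>

lemma monotone_layering_if_layering:
  assumes "layering g"
  shows "\<exists>G. monotone_layering G"
proof -
  have n1: "n \<ge> 1" and g0: "\<And>x. x < n \<Longrightarrow> g 0 x = x"
    and coh: "\<And>i x y. i < lam \<Longrightarrow> x < n \<Longrightarrow> y < n \<Longrightarrow> g i x = g i y \<Longrightarrow> g (Suc i) x = g (Suc i) y"
    and top: "\<And>x y. x < n \<Longrightarrow> y < n \<Longrightarrow> g lam x = g lam y"
    and sz: "\<And>i x. i \<in> {1..lam} \<Longrightarrow> x < n \<Longrightarrow> g i x < N i \<and>
        L i \<le> card {y. y < n \<and> g i y = g i x} \<and> card {y. y < n \<and> g i y = g i x} \<le> U i"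
    using assms unfolding layering_def by blast+
  \<comment> \<open>One more than the sum of all indices exceeds each of them, so that every index
    is a digit.\<close>
  define B where "B = Suc (\<Sum>i\<le>lam. \<Sum>x<n. g i x)"
  have gB: "g i x < B" if "i \<le> lam" "x < n" for i x
  proof -
    have "g i x \<le> (\<Sum>x<n. g i x)" using that by (intro member_le_sum) auto
    also have "\<dots> \<le> (\<Sum>i\<le>lam. \<Sum>x<n. g i x)" using that by (intro member_le_sum) auto
    finally show ?thesis by (simp add: B_def)
  qed
  \<comment> \<open>The index in the top layer is the most significant digit; \<open>K i\<close>
    keeps only the digits of the layers from \<open>i\<close> on.\<close>
  define K where "K i x = (\<Sum>j=i..lam. g j x * B ^ (j - i))" for i x
  have K_rec: "K i x = g i x + B * K (Suc i) x" if "i \<le> lam" for i x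
  proof -
    have "K i x = g i x + (\<Sum>j=Suc i..lam. g j x * B ^ (j - i))"
      using that by (simp add: K_def sum.atLeast_Suc_atMost)
    also have "(\<Sum>j=Suc i..lam. g j x * B ^ (j - i)) = B * K (Suc i) x"
      unfolding K_def sum_distrib_left
    proof (intro sum.cong refl)
      fix j assume "j \<in> {Suc i..lam}"
      then have "j - i = Suc (j - Suc i)" by (simp add: Suc_diff_Suc Suc_le_lessD)
      then show "g j x * B ^ (j - i) = B * (g j x * B ^ (j - Suc i))" by simp
    qed
    finally show ?thesis .
  qed
  have K_div: "K i x = K 0 x div B ^ i" if "i \<le> lam" "x < n" for i x
    using that
  proof (induction i)
    case (Suc i)
    have "K i x div B = K (Suc i) x"
      unfolding K_rec[OF Suc_leD[OF Suc.prems(1)]] using gB[of i x] Suc.prems by simp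
    moreover have "K i x = K 0 x div B ^ i" using Suc by simp
    ultimately show ?case by (simp add: div_mult2_eq[symmetric] mult.commute)
  qed simp
  \<comment> \<open>Downward induction on the layer: the last digit of \<open>K i x\<close> is
    \<open>g i x\<close>, and by coherence this index determines all the digits above it.\<close>
  have K_eq: "K i x = K i y \<longleftrightarrow> g i x = g i y" if "i \<le> lam" "x < n" "y < n" for i x y
    using \<open>i \<le> lam\<close>
  proof (induction rule: inc_induct)
    case base
    show ?case by (simp add: K_def)
  next
    case (step i)
    have "K i x mod B = g i x" "K i y mod B = g i y"
      using K_rec[of i] gB[of i] that step.hyps by simp_all
    moreover have "g i x = g i y \<Longrightarrow> K i x = K i y"
      using coh[of i x y] step K_rec[of i] that by simp
    ultimately show ?case by metis
  qed
  define xs where "xs = sort_key (K 0) [0..<n]"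
  have len: "length xs = n" and set: "set xs = {..<n}" and dist: "distinct xs"
    and srt: "sorted (map (K 0) xs)"
    by (auto simp: xs_def)
  define \<pi> where "\<pi> = (!) xs"
  have bij: "bij_betw \<pi> {..<n} {..<n}"
    unfolding \<pi>_def by (rule bij_betw_nth) (simp_all add: dist len set)
  have \<pi>n: "\<pi> t < n" if "t < n" for t using bij_betwE[OF bij] that by simp
  define G where "G i t = K i (\<pi> t)" for i t
  have G_eq: "G i s = G i t \<longleftrightarrow> g i (\<pi> s) = g i (\<pi> t)" if "i \<le> lam" "s < n" "t < n" for i s t
    unfolding G_def using K_eq that \<pi>n by simp
  have "monotone_layering G"
    unfolding monotone_layering_def
  proof (intro conjI allI impI ballI)
    show "1 \<le> n" by (fact n1)
    show "inj_on (G 0) {..<n}"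
      using G_eq[of 0] g0 \<pi>n bij by (auto simp: inj_on_def bij_betw_def)
    \<comment> \<open>The leaves are sorted by \<open>K 0\<close> alone. Integer division by a power
      of \<open>B\<close> is monotone and carries the order to every layer.\<close>
    show "G i x \<le> G i y" if "i \<le> lam" "x \<le> y" "y < n" for i x y
    proof -
      have "K 0 (\<pi> x) \<le> K 0 (\<pi> y)"
        using sorted_nth_mono[OF srt that(2)] that len by (simp add: \<pi>_def)
      then show ?thesis unfolding G_def using K_div[of i] that \<pi>n by (simp add: div_le_mono)
    qed
    show "G (Suc i) x = G (Suc i) y" if "i < lam" "x < n" "y < n" "G i x = G i y" for i x y
      using that G_eq[of i x y] G_eq[of "Suc i" x y] coh[of i "\<pi> x" "\<pi> y"] \<pi>n by simp
    show "G lam x = G lam y" if "x < n" "y < n" for x y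
      using that G_eq[of lam x y] top[of "\<pi> x" "\<pi> y"] \<pi>n by simp
  next
    fix i assume i: "i \<in> {1..lam}"
    \<comment> \<open>Keys may exceed \<open>N i\<close>; what stays bounded is the number of
      distinct keys, which depends only on the fibres.\<close>
    have "card (G i ` {..<n}) = card ((\<lambda>t. g i (\<pi> t)) ` {..<n})"
      using G_eq i by (intro card_image_eq_if_same_kernel) simp
    also have "\<dots> = card (g i ` {..<n})"
      using bij unfolding bij_betw_def by (metis image_image)
    also have "\<dots> \<le> card {..<N i}"
      using sz[OF i] by (intro card_mono) auto
    finally show "card (G i ` {..<n}) \<le> N i" by simp
    fix x assume x: "x < n"
    have "bij_betw \<pi> {y. y < n \<and> G i y = G i x} {y. y < n \<and> g i y = g i (\<pi> x)}"
      unfolding bij_betw_def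
    proof (intro conjI set_eqI iffI)
      show "inj_on \<pi> {y. y < n \<and> G i y = G i x}"
        using bij unfolding bij_betw_def by (rule inj_on_subset[OF conjunct1]) auto
    next
      fix z assume "z \<in> \<pi> ` {y. y < n \<and> G i y = G i x}"
      then show "z \<in> {y. y < n \<and> g i y = g i (\<pi> x)}"
        using G_eq[of i _ x] x i \<pi>n by auto
    next
      fix z assume z: "z \<in> {y. y < n \<and> g i y = g i (\<pi> x)}"
      then obtain y where "y < n" "z = \<pi> y" using bij by (auto simp: bij_betw_def)
      then show "z \<in> \<pi> ` {y. y < n \<and> G i y = G i x}"
        using z G_eq[of i y x] x i by auto
    qed
    then have "card {y. y < n \<and> G i y = G i x} = card {y. y < n \<and> g i y = g i (\<pi> x)}"
      by (rule bij_betw_same_card)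
    then show "L i \<le> card {y. y < n \<and> G i y = G i x}" "card {y. y < n \<and> G i y = G i x} \<le> U i"
      using sz[OF i \<pi>n[OF x]] by simp_all
  qed
  then show ?thesis by blast
qed

text \<open>Before leaf \<open>p\<close> the scan completes exactly the layers in which the labels
  of \<open>p - 1\<close> and \<open>p\<close> differ.\<close>

lemma accepting_if_monotone_layering:
  assumes "monotone_layering G"
  shows "\<exists>b c. reach n b c \<and> accepting n b c"
proof -
  have n1: "n \<ge> 1" and inj: "inj_on (G 0) {..<n}"
    and mono: "\<And>i x y. i \<le> lam \<Longrightarrow> x \<le> y \<Longrightarrow> y < n \<Longrightarrow> G i x \<le> G i y"
    and coh: "\<And>i x y. i < lam \<Longrightarrow> x < n \<Longrightarrow> y < n \<Longrightarrow> G i x = G i y \<Longrightarrow> G (Suc i) x = G (Suc i) y"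
    and top: "\<And>x y. x < n \<Longrightarrow> y < n \<Longrightarrow> G lam x = G lam y"
    and cnt: "\<And>i. i \<in> {1..lam} \<Longrightarrow> card (G i ` {..<n}) \<le> N i"
    and sz: "\<And>i x. i \<in> {1..lam} \<Longrightarrow> x < n \<Longrightarrow>
        L i \<le> card {y. y < n \<and> G i y = G i x} \<and> card {y. y < n \<and> G i y = G i x} \<le> U i"
    using assms unfolding monotone_layering_def by blast+
  \<comment> \<open>The labels seen so far include that of the current vertex, which
    \<open>c i\<close> does not count yet; hence the \<open>+ 1\<close>.\<close>
  define inv where "inv p b c \<longleftrightarrow> (\<forall>i\<le>lam. {x. x < p \<and> G i x = G i (p - 1)} = {b i..<p} \<and>
      c i + 1 = card (G i ` {..<p}))" for p b c
  have ok: "complete_ok p b c i"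
    if inv: "inv p b c" and i: "i \<in> {1..lam}" and p: "p \<in> {1..n}"
      and brk: "p < n \<Longrightarrow> G i (p - 1) \<noteq> G i p" for p b c i
  proof -
    \<comment> \<open>By monotonicity a label that changes at \<open>p\<close> never returns, so the
      leaves of the vertex seen so far are all its leaves. At \<open>p = n\<close> there is nothing
      left to see.\<close>
    have "{x. x < n \<and> G i x = G i (p - 1)} = {x. x < p \<and> G i x = G i (p - 1)}"
    proof (intro set_eqI iffI)
      fix x assume x: "x \<in> {x. x < n \<and> G i x = G i (p - 1)}"
      have "x < p"
      proof (rule ccontr)
        assume "\<not> x < p"
        then have "p < n" "G i (p - 1) \<le> G i p" "G i p \<le> G i x"
          using x i mono[of i "p - 1" p] mono[of i p x] by auto
        then show False using brk x by simp
      qed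
      then show "x \<in> {x. x < p \<and> G i x = G i (p - 1)}" using x by simp
    qed (use p in auto)
    also have "\<dots> = {b i..<p}" using inv i by (simp add: inv_def)
    finally have "card {x. x < n \<and> G i x = G i (p - 1)} = p - b i" by simp
    then have "L i \<le> p - b i \<and> p - b i \<le> U i" using sz[OF i, of "p - 1"] p by auto
    moreover have "c i < N i"
    proof -
      have "c i + 1 = card (G i ` {..<p})" using inv i by (simp add: inv_def)
      also have "\<dots> \<le> card (G i ` {..<n})" using p by (intro card_mono) auto
      also have "\<dots> \<le> N i" using cnt[OF i] .
      finally show ?thesis by simp
    qed
    ultimately show ?thesis by (simp add: complete_ok_def)
  qed
  have "\<exists>b c. reach p b c \<and> inv p b c" if "1 \<le> p" "p \<le> n" for p
    using that
  proof (induction p rule: dec_induct)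
    case base
    have "inv 1 (\<lambda>_. 0) (\<lambda>_. 0)" by (auto simp: inv_def lessThan_Suc)
    then show ?case using init by blast
  next
    case (step p)
    then obtain b c where r: "reach p b c" and v: "inv p b c" by auto
    have pn: "p < n" using step by simp
    \<comment> \<open>Coherence read backwards: labels that differ in one layer differ in the layer
      below. Layer 0 always changes, so the changing layers are \<open>0, ..., h\<close> for some
      \<open>h\<close>.\<close>
    have "\<exists>h\<le>m. \<forall>i\<le>m. G i (p - 1) \<noteq> G i p \<longleftrightarrow> i \<le> h" if "m \<le> lam" for m
      using that
    proof (induction m)
      case 0
      have "G 0 (p - 1) \<noteq> G 0 p" using inj pn step.hyps(1) unfolding inj_on_def
        by (metis One_nat_def Suc_pred lessThan_iff less_imp_diff_less less_eq_Suc_le n_not_Suc_n)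
      then show ?case by auto
    next
      case (Suc m)
      then obtain h where h: "h \<le> m" "\<forall>i\<le>m. G i (p - 1) \<noteq> G i p \<longleftrightarrow> i \<le> h" by auto
      show ?case
      proof (cases "G (Suc m) (p - 1) = G (Suc m) p")
        case True
        then show ?thesis using h by (intro exI[of _ h]) (auto simp: le_Suc_eq)
      next
        case False
        then have "G m (p - 1) \<noteq> G m p" using coh[of m "p - 1" p] Suc.prems pn less_imp_diff_less by auto
        then have "h = m" using h by auto
        then show ?thesis using h False by (intro exI[of _ "Suc m"]) (auto simp: le_Suc_eq)
      qed
    qed
    then obtain h where h: "h \<le> lam" "\<And>i. i \<le> lam \<Longrightarrow> G i (p - 1) \<noteq> G i p \<longleftrightarrow> i \<le> h"
      by auto
    have "reach (Suc p) (next_start h p b) (next_count h c)"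
    proof (rule reach.step[OF r h(1)], rule ballI)
      fix i assume "i \<in> {1..h}"
      then show "complete_ok p b c i"
        using v h step pn by (intro ok) auto
    qed
    moreover have "inv (Suc p) (next_start h p b) (next_count h c)"
      unfolding inv_def
    proof (intro allI impI conjI)
      fix i assume i: "i \<le> lam"
      have cur: "{x. x < p \<and> G i x = G i (p - 1)} = {b i..<p}"
        and ct: "c i + 1 = card (G i ` {..<p})" using v i by (auto simp: inv_def)
      have bp: "b i < p" using reach_bounds[OF r] by simp
      have img: "G i ` {..<Suc p} = insert (G i p) (G i ` {..<p})" by (simp add: lessThan_Suc)
      show "{x. x < Suc p \<and> G i x = G i (Suc p - 1)} = {next_start h p b i..<Suc p}"
      proof (cases "i \<le> h")
        case True
        have "G i x \<noteq> G i p" if "x < p" for x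
        proof -
          have "G i x \<le> G i (p - 1)" "G i (p - 1) \<le> G i p" using that i pn by (auto intro!: mono)
          then show ?thesis using h(2)[OF i] True by simp
        qed
        then have "{x. x < Suc p \<and> G i x = G i (Suc p - 1)} = {p}" by (auto simp: less_Suc_eq)
        then show ?thesis using True by (auto simp: next_start_def)
      next
        case False
        then have "G i p = G i (p - 1)" using h(2)[OF i] by simp
        then have "{x. x < Suc p \<and> G i x = G i (Suc p - 1)}
            = insert p {x. x < p \<and> G i x = G i (p - 1)}" by (auto simp: less_Suc_eq)
        also have "\<dots> = {next_start h p b i..<Suc p}"
          unfolding cur using False bp by (auto simp: next_start_def)
        finally show ?thesis .
      qed
      show "next_count h c i + 1 = card (G i ` {..<Suc p})"
      proof (cases "i \<le> h")
        case True
        have "G i p \<notin> G i ` {..<p}"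
        proof
          assume "G i p \<in> G i ` {..<p}"
          then obtain x where "x < p" "G i x = G i p" by auto
          moreover have "G i x \<le> G i (p - 1)" "G i (p - 1) \<le> G i p"
            using \<open>x < p\<close> i pn by (auto intro!: mono)
          ultimately show False using h(2)[OF i] True by simp
        qed
        then show ?thesis using img ct True by (simp add: next_count_def)
      next
        case False
        then have "G i p = G i (p - 1)" using h(2)[OF i] by simp
        then have "G i p \<in> G i ` {..<p}" using step.hyps(1) by auto
        then show ?thesis using img ct False by (simp add: next_count_def insert_absorb)
      qed
    qed
    ultimately show ?case by blast
  qed
  then obtain b c where r: "reach n b c" and v: "inv n b c" using n1 by blast
  have "G lam 0 = G lam (n - 1)" using n1 by (intro top) simp_all
  then have "0 \<in> {x. x < n \<and> G lam x = G lam (n - 1)}" using n1 by simp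
  also have "\<dots> = {b lam..<n}" using v by (simp add: inv_def)
  finally have "b lam = 0" by simp
  moreover have "\<forall>i\<in>{1..lam}. complete_ok n b c i" using ok[OF v] n1 by auto
  ultimately show ?thesis using r unfolding accepting_def by blast
qed

lemma layering_iff_accepting: "(\<exists>g. layering g) \<longleftrightarrow> (\<exists>b c. reach n b c \<and> accepting n b c)"
  using layering_if_accepting monotone_layering_if_layering accepting_if_monotone_layering by blast

end

section \<open>From layer trees to layerings\<close>

abbreviation clt_layering :: "clt_instance \<Rightarrow> (nat \<Rightarrow> nat \<Rightarrow> nat) \<Rightarrow> bool" where
  "clt_layering I \<equiv>
     layers.layering (layer_size I 0) (num_layers I) (layer_size I) (lower_cap I) (upper_cap I)"

lemma wf_complete_layered_graph: "wf_digraph (with_proj (complete_layered_graph I))"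
  by unfold_locales (auto simp: complete_layered_graph_def)

text \<open>Below the root every vertex has a unique parent, so iterating the parent map from a leaf
  lists everything reachable from that leaf, one vertex per layer. Weights thus become sizes of
  fibres of the iterated map.\<close>

lemma layering_if_constrained_layer_tree:
  assumes "constrained_layer_tree I"
  shows "\<exists>g. clt_layering I g"
proof -
  define n where "n = layer_size I 0"
  define lam where "lam = num_layers I"
  obtain T where sub: "subgraph (with_proj T) (with_proj (complete_layered_graph I))"
    and lt: "layer_tree lam T"
    and lv: "{v \<in> pverts (complete_layered_graph I). layer v = 0} \<subseteq> leaves T"
    and cap: "\<And>v. v \<in> pverts T \<Longrightarrow> layer v \<ge> 1 \<Longrightarrow>
       lower_cap I (layer v) \<le> weight T v \<and> weight T v \<le> upper_cap I (layer v)"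
    using assms unfolding constrained_layer_tree_def lam_def by blast
  obtain r where rt: "rooted_tree T r" and top: "{v \<in> pverts T. layer v = lam} = {r}"
    using lt unfolding layer_tree_def by blast
  have lay: "v \<in> pverts T \<Longrightarrow> layer v \<le> lam" "v \<in> leaves T \<Longrightarrow> layer v = 0"
    "(u, v) \<in> parcs T \<Longrightarrow> layer v = layer u + 1" for u v
    using lt unfolding layer_tree_def by auto
  have verts: "v \<in> pverts T \<Longrightarrow> snd v < layer_size I (layer v)" for v
    using sub unfolding subgraph_def by (auto simp: complete_layered_graph_def)
  interpret T: pair_fin_digraph T using rt by (simp add: rooted_tree_def)
  have leaves_eq: "leaves T = {(0, x) | x. x < n}"
  proof (intro set_eqI iffI)
    fix v assume "v \<in> leaves T"
    then show "v \<in> {(0::nat, x) | x. x < n}"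
      using lay(2)[of v] verts[of v] by (cases v) (auto simp: leaves_def n_def)
  next
    fix v assume "v \<in> {(0::nat, x) | x. x < n}"
    then show "v \<in> leaves T" using lv by (auto simp: complete_layered_graph_def n_def)
  qed
  have leaf_vert: "x < n \<Longrightarrow> (0, x) \<in> pverts T" for x
    using leaves_eq unfolding leaves_def by blast
  have parent: "\<exists>!w. (v, w) \<in> parcs T" if "v \<in> pverts T" "layer v < lam" for v
  proof -
    have "v \<noteq> r" using top that by auto
    then have "card (out_arcs (with_proj T) v) = 1"
      using rt that unfolding rooted_tree_def out_degree_def by blast
    then obtain e where "out_arcs (with_proj T) v = {e}" by (auto simp: card_1_singleton_iff)
    then have "{e' \<in> parcs T. fst e' = v} = {e}" by (simp add: out_arcs_def)
    then show ?thesis by (metis (mono_tags, lifting) fst_conv mem_Collect_eq prod.collapse singletonD singletonI snd_conv)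
  qed
  define par where "par v = (THE w. (v, w) \<in> parcs T)" for v
  have par: "(v, par v) \<in> parcs T" if "v \<in> pverts T" "layer v < lam" for v
    unfolding par_def by (rule theI'[OF parent[OF that]])
  have par_eq: "w = par v" if "(v, w) \<in> parcs T" for v w
  proof -
    have "v \<in> pverts T" "w \<in> pverts T" using that T.wellformed' by auto
    then have "layer v < lam" using lay(1)[of w] lay(3)[OF that] by simp
    then show ?thesis using parent[OF \<open>v \<in> pverts T\<close>] par[OF \<open>v \<in> pverts T\<close>] that by blast
  qed
  define F where "F i x = (par ^^ i) (0, x)" for i x
  have F0: "F 0 x = (0, x)" and FSuc: "F (Suc i) x = par (F i x)" for i x
    by (simp_all add: F_def)
  have F: "F i x \<in> pverts T \<and> layer (F i x) = i \<and> (0, x) \<rightarrow>\<^sup>*\<^bsub>with_proj T\<^esub> F i x"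
    if "i \<le> lam" "x < n" for i x
    using that
  proof (induction i)
    case 0
    then show ?case using leaf_vert by (simp add: F0)
  next
    case (Suc i)
    then have arc: "(F i x, F (Suc i) x) \<in> parcs T" using par[of "F i x"] by (simp add: FSuc)
    have "(0, x) \<rightarrow>\<^sup>*\<^bsub>with_proj T\<^esub> F i x" "layer (F i x) = i" using Suc by auto
    then show ?case
      using arc lay(3)[OF arc] T.in_arcsD2[OF arc] T.reachable_adj_trans[of "(0, x)" "F i x" "F (Suc i) x"]
      by simp
  qed
  have reach_F: "v = F (layer v) x" if "(0, x) \<rightarrow>\<^sup>*\<^bsub>with_proj T\<^esub> v" for v x
    using that
  proof (induction rule: T.reachable_induct)
    case (step v w)
    have "layer w = Suc (layer v)" "w = par v" using step.hyps(2) lay(3)[of v w] par_eq[of v w] by simp_all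
    moreover have "par v = F (Suc (layer v)) x" unfolding FSuc using step.IH by (rule arg_cong)
    ultimately show ?case by simp
  qed (simp add: F0)
  have weight: "weight T (F i x) = card {y. y < n \<and> F i y = F i x}" if "i \<le> lam" "x < n" for i x
  proof -
    have "{z \<in> leaves T. z \<rightarrow>\<^sup>*\<^bsub>with_proj T\<^esub> F i x} = Pair 0 ` {y. y < n \<and> F i y = F i x}"
    proof (intro set_eqI iffI)
      fix z assume "z \<in> {z \<in> leaves T. z \<rightarrow>\<^sup>*\<^bsub>with_proj T\<^esub> F i x}"
      then obtain y where y: "z = (0, y)" "y < n" "(0, y) \<rightarrow>\<^sup>*\<^bsub>with_proj T\<^esub> F i x"
        unfolding leaves_eq by blast
      then show "z \<in> Pair 0 ` {y. y < n \<and> F i y = F i x}"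
        using reach_F[OF y(3)] F[OF that] by auto
    next
      fix z assume "z \<in> Pair (0::nat) ` {y. y < n \<and> F i y = F i x}"
      then show "z \<in> {z \<in> leaves T. z \<rightarrow>\<^sup>*\<^bsub>with_proj T\<^esub> F i x}"
        using F[of i] that(1) unfolding leaves_eq by auto metis
    qed
    then show ?thesis unfolding weight_def by (simp add: card_image inj_on_def)
  qed
  have snd_eq: "snd (F i x) = snd (F i y) \<longleftrightarrow> F i x = F i y" if "i \<le> lam" "x < n" "y < n" for i x y
    using F[of i x] F[of i y] that by (auto simp: prod_eq_iff)
  \<comment> \<open>A vertex in the lowest occupied layer has no incoming arc. It is therefore a
    leaf, and so it lies in layer 0.\<close>
  have "n \<ge> 1"
  proof -
    have "pverts T \<noteq> {}" using rt by (auto simp: rooted_tree_def)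
    then obtain v where v: "v \<in> pverts T" "\<And>w. w \<in> pverts T \<Longrightarrow> layer v \<le> layer w"
      using arg_min_if_finite[OF T.pair_finite_verts, of layer] by (metis not_less)
    have "in_arcs (with_proj T) v = {}"
    proof (rule ccontr)
      assume "in_arcs (with_proj T) v \<noteq> {}"
      then obtain u where "(u, v) \<in> parcs T" by (auto simp: in_arcs_def)
      then show False using v(2)[of u] lay(3)[of u v] T.wellformed' by auto
    qed
    then have "v \<in> leaves T" using v by (simp add: leaves_def in_degree_def)
    then show ?thesis unfolding leaves_eq by auto
  qed
  have "clt_layering I (\<lambda>i x. snd (F i x))"
    unfolding layers.layering_def n_def[symmetric] lam_def[symmetric]
  proof (intro conjI allI impI ballI)
    show "1 \<le> n" by fact
    show "snd (F 0 x) = x" for x by (simp add: F0)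
    show "snd (F (Suc i) x) = snd (F (Suc i) y)"
      if "i < lam" "x < n" "y < n" "snd (F i x) = snd (F i y)" for i x y
      using that snd_eq[of i x y] by (simp add: FSuc)
    show "snd (F lam x) = snd (F lam y)" if "x < n" "y < n" for x y
    proof -
      have "F lam x \<in> {r}" "F lam y \<in> {r}"
        using F[of lam] that unfolding top[symmetric] by auto
      then show ?thesis by simp
    qed
  next
    fix i x assume i: "i \<in> {1..lam}" and x: "x < n"
    have "{y. y < n \<and> snd (F i y) = snd (F i x)} = {y. y < n \<and> F i y = F i x}"
      using snd_eq i x by auto
    then have w: "card {y. y < n \<and> snd (F i y) = snd (F i x)} = weight T (F i x)"
      using weight i x by simp
    show "snd (F i x) < layer_size I i"
      using verts[of "F i x"] F[of i x] i x by simp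
    show "lower_cap I i \<le> card {y. y < n \<and> snd (F i y) = snd (F i x)}"
      "card {y. y < n \<and> snd (F i y) = snd (F i x)} \<le> upper_cap I i"
      unfolding w using cap[of "F i x"] F[of i x] i x by simp_all
  qed
  then show ?thesis by blast
qed

text \<open>The tree keeps only the vertices that are ancestors of some leaf. Hence every vertex
  above layer 0 has a child, and no leaf occurs outside layer 0.\<close>

lemma constrained_layer_tree_if_layering:
  assumes "clt_layering I g"
  shows "constrained_layer_tree I"
proof -
  define n where "n = layer_size I 0"
  define lam where "lam = num_layers I"
  have n1: "n \<ge> 1" and g0: "\<And>x. x < n \<Longrightarrow> g 0 x = x"
    and coh: "\<And>i x y. i < lam \<Longrightarrow> x < n \<Longrightarrow> y < n \<Longrightarrow> g i x = g i y \<Longrightarrow> g (Suc i) x = g (Suc i) y"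
    and top: "\<And>x y. x < n \<Longrightarrow> y < n \<Longrightarrow> g lam x = g lam y"
    and sz: "\<And>i x. i \<in> {1..lam} \<Longrightarrow> x < n \<Longrightarrow> g i x < layer_size I i \<and>
        lower_cap I i \<le> card {y. y < n \<and> g i y = g i x} \<and>
        card {y. y < n \<and> g i y = g i x} \<le> upper_cap I i"
    using assms unfolding layers.layering_def n_def lam_def by blast+
  define T :: "vertex pair_pre_digraph" where
    "T = \<lparr>pverts = {(i, g i x) | i x. i \<le> lam \<and> x < n},
          parcs = {((i, g i x), (Suc i, g (Suc i) x)) | i x. i < lam \<and> x < n}\<rparr>"
  have vert: "(i, k) \<in> pverts T \<longleftrightarrow> i \<le> lam \<and> (\<exists>x<n. k = g i x)" for i k
    by (auto simp: T_def)
  have arc: "((i, k), (j, l)) \<in> parcs T \<longleftrightarrow>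
      i < lam \<and> j = Suc i \<and> (\<exists>x<n. k = g i x \<and> l = g (Suc i) x)" for i j k l
    by (auto simp: T_def)
  have "pverts T = (\<lambda>(i, x). (i, g i x)) ` ({..lam} \<times> {..<n})"
    by (auto simp: T_def)
  then have fin: "finite (pverts T)" by simp
  have "parcs T = (\<lambda>(i, x). ((i, g i x), (Suc i, g (Suc i) x))) ` ({..<lam} \<times> {..<n})"
    by (auto simp: T_def)
  then have fina: "finite (parcs T)" by simp
  interpret T: pair_fin_digraph T
    by unfold_locales (use fin fina in \<open>auto simp: T_def\<close>)
  have gbound: "g i x < layer_size I i" if "i \<le> lam" "x < n" for i x
    using sz[of i x] g0[of x] that by (cases "i = 0") (auto simp: n_def)
  have sub: "subgraph (with_proj T) (with_proj (complete_layered_graph I))"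
    unfolding subgraph_def
  proof (intro conjI wf_complete_layered_graph T.wf_digraph)
    show "verts (with_proj T) \<subseteq> verts (with_proj (complete_layered_graph I))"
      using gbound by (auto simp: T_def complete_layered_graph_def lam_def)
    show "arcs (with_proj T) \<subseteq> arcs (with_proj (complete_layered_graph I))"
      using gbound by (auto simp: T_def complete_layered_graph_def lam_def)
  qed (simp add: compatible_def)
  have up: "(i, g i x) \<rightarrow>\<^sup>*\<^bsub>with_proj T\<^esub> (i + d, g (i + d) x)" if "i + d \<le> lam" "x < n" for i d x
    using that
  proof (induction d)
    case 0
    then have "(i, g i x) \<in> pverts T" using vert by auto
    then show ?case by simp
  next
    case (Suc d)
    then have "((i + d, g (i + d) x), (i + Suc d, g (i + Suc d) x)) \<in> parcs T"
      using arc by auto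
    then show ?case using Suc T.reachable_adj_trans by simp
  qed
  have reach_g: "v = (layer v, g (layer v) x)" if "(0, x) \<rightarrow>\<^sup>*\<^bsub>with_proj T\<^esub> v" "x < n" for v x
    using that
  proof (induction rule: T.reachable_induct)
    case base
    then show ?case using g0 by simp
  next
    case (step v w)
    obtain y where "y < n" "layer v < lam" "snd v = g (layer v) y" "w = (Suc (layer v), g (Suc (layer v)) y)"
      using step.hyps(2) arc[of "fst v" "snd v" "fst w" "snd w"] by (auto simp: prod_eq_iff)
    then show ?case using step.IH[OF step.prems] coh[of "layer v" y x] step.prems
      by (simp add: prod_eq_iff)
  qed
  \<comment> \<open>The arc is defined through a leaf \<open>x\<close>; coherence makes its head the
    same for all leaves below the vertex, which gives out-degree 1.\<close>
  have out: "out_arcs (with_proj T) (i, g i x) =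
      (if i < lam then {((i, g i x), (Suc i, g (Suc i) x))} else {})" if "x < n" for i x
  proof (intro set_eqI iffI)
    fix e assume "e \<in> out_arcs (with_proj T) (i, g i x)"
    then obtain y where "e = ((i, g i y), (Suc i, g (Suc i) y))" "i < lam" "y < n" "g i y = g i x"
      by (auto simp: out_arcs_def T_def)
    then show "e \<in> (if i < lam then {((i, g i x), (Suc i, g (Suc i) x))} else {})"
      using coh[of i y x] that by simp
  next
    fix e assume "e \<in> (if i < lam then {((i, g i x), (Suc i, g (Suc i) x))} else {})"
    then show "e \<in> out_arcs (with_proj T) (i, g i x)"
      using that by (auto simp: out_arcs_def T_def split: if_splits)
  qed
  have leaves_eq: "leaves T = {(0, x) | x. x < n}"
  proof (intro set_eqI iffI)
    fix v assume v: "v \<in> leaves T"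
    then obtain i x where x: "v = (i, g i x)" "i \<le> lam" "x < n" by (auto simp: leaves_def T_def)
    have "i = 0"
    proof (rule ccontr)
      assume "i \<noteq> 0"
      then obtain j where "i = Suc j" using not0_implies_Suc by blast
      then have "((j, g j x), v) \<in> in_arcs (with_proj T) v"
        using x by (auto simp: in_arcs_def T_def)
      then have "in_degree (with_proj T) v \<noteq> 0"
        unfolding in_degree_def by (metis T.finite_in_arcs card_0_eq empty_iff)
      then show False using v by (simp add: leaves_def)
    qed
    then show "v \<in> {(0::nat, x) | x. x < n}" using x g0 by auto
  next
    fix v assume "v \<in> {(0::nat, x) | x. x < n}"
    then obtain x where "v = (0, x)" "x < n" by blast
    moreover have "in_arcs (with_proj T) (0, x) = {}" by (auto simp: in_arcs_def T_def)
    moreover have "(0, x) \<in> pverts T" using vert g0 \<open>x < n\<close> by force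
    ultimately show "v \<in> leaves T" by (simp add: leaves_def in_degree_def)
  qed
  have weight: "weight T (i, g i x) = card {y. y < n \<and> g i y = g i x}" if "i \<le> lam" "x < n" for i x
  proof -
    have "{z \<in> leaves T. z \<rightarrow>\<^sup>*\<^bsub>with_proj T\<^esub> (i, g i x)} = Pair 0 ` {y. y < n \<and> g i y = g i x}"
    proof (intro set_eqI iffI)
      fix z assume "z \<in> {z \<in> leaves T. z \<rightarrow>\<^sup>*\<^bsub>with_proj T\<^esub> (i, g i x)}"
      then obtain y where "z = (0, y)" "y < n" "(0, y) \<rightarrow>\<^sup>*\<^bsub>with_proj T\<^esub> (i, g i x)"
        unfolding leaves_eq by blast
      then show "z \<in> Pair 0 ` {y. y < n \<and> g i y = g i x}"
        using reach_g by fastforce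
    next
      fix z assume "z \<in> Pair (0::nat) ` {y. y < n \<and> g i y = g i x}"
      then obtain y where y: "z = (0, y)" "y < n" "g i y = g i x" by blast
      then show "z \<in> {z \<in> leaves T. z \<rightarrow>\<^sup>*\<^bsub>with_proj T\<^esub> (i, g i x)}"
        using up[of 0 i y] that(1) g0[of y] unfolding leaves_eq by simp
    qed
    then show ?thesis unfolding weight_def by (simp add: card_image inj_on_def)
  qed
  define r where "r = (lam, g lam 0)"
  have top': "g lam x = g lam 0" if "x < n" for x
    using n1 that by (intro top) auto
  have "rooted_tree T r"
    unfolding rooted_tree_def
  proof (intro conjI ballI)
    show "pair_fin_digraph T" by unfold_locales
    show "r \<in> pverts T" using n1 vert unfolding r_def by (auto simp: Suc_le_eq)
    show "out_degree (with_proj T) r = 0"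
      using out[of 0 lam] n1 by (simp add: r_def out_degree_def)
    show "v \<rightarrow>\<^sup>*\<^bsub>with_proj T\<^esub> r" if "v \<in> pverts T" for v
    proof -
      from that obtain i x where v: "v = (i, g i x)" "i \<le> lam" "x < n" by (auto simp: T_def)
      then show ?thesis using up[of i "lam - i" x] top'[of x] by (simp add: r_def)
    qed
    show "out_degree (with_proj T) v = 1" if "v \<in> pverts T - {r}" for v
    proof -
      have "v \<in> pverts T" using that by simp
      then obtain i x where v: "v = (i, g i x)" "i \<le> lam" "x < n" by (auto simp: T_def)
      then have "i \<noteq> lam" using that top'[of x] by (auto simp: r_def)
      then show ?thesis using v out[of x i] by (simp add: out_degree_def)
    qed
  qed
  moreover have "{v \<in> pverts T. layer v = lam} = {r}"
  proof
    show "{v \<in> pverts T. layer v = lam} \<subseteq> {r}"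
    proof
      fix v assume "v \<in> {v \<in> pverts T. layer v = lam}"
      then obtain x where "v = (lam, g lam x)" "x < n" by (auto simp: T_def)
      then show "v \<in> {r}" using top'[of x] by (simp add: r_def)
    qed
    show "{r} \<subseteq> {v \<in> pverts T. layer v = lam}"
      using n1 vert unfolding r_def by (auto simp: Suc_le_eq)
  qed
  moreover have "\<forall>v\<in>pverts T. layer v \<le> lam" "\<forall>(u, v)\<in>parcs T. layer v = layer u + 1"
    by (auto simp: T_def)
  moreover have "\<forall>v\<in>{(0::nat, x) | x. x < n}. layer v = 0" by auto
  ultimately have "layer_tree lam T"
    unfolding layer_tree_def leaves_eq by blast
  moreover have "{v \<in> pverts (complete_layered_graph I). layer v = 0} \<subseteq> leaves T"
    unfolding leaves_eq by (auto simp: complete_layered_graph_def n_def)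
  moreover have "lower_cap I (layer v) \<le> weight T v \<and> weight T v \<le> upper_cap I (layer v)"
    if "v \<in> pverts T" "layer v \<ge> 1" for v
  proof -
    from that(1) obtain i x where "v = (i, g i x)" "i \<le> lam" "x < n" by (auto simp: T_def)
    then show ?thesis using sz[of i x] weight[of i x] that(2) by simp
  qed
  ultimately show ?thesis
    unfolding constrained_layer_tree_def lam_def using sub by blast
qed

lemma constrained_layer_tree_iff:
  "constrained_layer_tree I \<longleftrightarrow> (\<exists>g. clt_layering I g)"
  using layering_if_constrained_layer_tree constrained_layer_tree_if_layering by blast

section \<open>The program\<close>

lemma ach_Seq_Block:
  assumes "blk is R M (\<lambda>R' M'. ach d R' M' Td Q)" "length is + Td \<le> T"
  shows "ach (Seq (Block is) d) R M T Q"
  using ach_Seq[OF ach_Block[OF assms(1) order_refl] assms(2)] .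

text \<open>Naming the one intermediate state keeps the goals of a long sequence free of nested
  postconditions.\<close>

lemma ach_Seq_det:
  assumes "ach c R M Tc (\<lambda>R' M'. R' = R1 \<and> M' = M1)" "ach d R1 M1 Td Q" "Tc + Td \<le> T"
  shows "ach (Seq c d) R M T Q"
  by (rule ach_Seq[OF ach_mono[OF assms(1) order_refl] assms(3)]) (use assms(2) in auto)

text \<open>Register 3 holds 1, and register 22 is never written, so that it holds 0. Register 0 is the
  output, registers 1 and 2 hold \<open>n\<close> and \<open>lam\<close>, register 4 the number \<open>n ^ (2 * lam)\<close> and register 5
  the address of that power. Registers 6 and 7 count the positions \<open>p\<close> down and up; registers 8 and 9 do so
  for the codes of the states at \<open>p\<close>, and register 10 is the address of the mark of the current state.
  While a state is visited, register 11 counts the remaining layers, registers 12 and 13 point to the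
  capacities and to the powers of \<open>n\<close>, register 14 holds the digits not yet decoded and register 15 the
  address of the successor. Register 16 is \<open>b i\<close> for the last completed layer \<open>i\<close>, starting from
  \<open>b 0 = p - 1\<close>, and it is set to 1 when a capacity is violated. All layers pass with a single
  root exactly if it ends up as 0, even for \<open>lam = 0\<close>.\<close>

definition add_multiple :: "nat \<Rightarrow> nat \<Rightarrow> nat \<Rightarrow> com" where
  "add_multiple a w k = Loop k (Block [Add a a w, Sub k k 3])"

text \<open>Truncated subtraction serves as the comparison: with \<open>x\<close> in register 14 and
  the divisor \<open>W\<close> in register 17, register 18 holds \<open>x + 1 - W\<close>, which is
  positive exactly if \<open>W \<le> x\<close>.\<close>

definition divide :: "nat \<Rightarrow> com" where
  "divide j = Seq (Block [Add 18 14 3, Sub 18 18 17])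
     (Loop 18 (Block [Sub 14 14 17, Add j j 3, Add 18 14 3, Sub 18 18 17]))"

lemma ach_add_multiple:
  assumes "distinct [a, w, k, 3]" "R 3 = 1"
  shows "ach (add_multiple a w k) R M (4 * R k + 2)
    (\<lambda>R' M'. R' = R(a := R a + R k * R w, k := 0) \<and> M' = M)"
  unfolding add_multiple_def
proof (rule ach_Loop[where f = "\<lambda>R'. R' k" and Tb = 2 and
    I = "\<lambda>R' M'. R' k \<le> R k \<and> R' = R(a := R a + (R k - R' k) * R w, k := R' k) \<and> M' = M"])
  fix R' M' assume inv: "R' k \<le> R k \<and> R' = R(a := R a + (R k - R' k) * R w, k := R' k) \<and> M' = M"
    and pos: "R' k > 0"
  define m where "m = R' k"
  have R': "R' = R(a := R a + (R k - m) * R w, k := m)" and m: "0 < m" "m \<le> R k" "M' = M"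
    using inv pos unfolding m_def by auto
  have "R k - (m - 1) = Suc (R k - m)" using m by simp
  then have step: "(R k - m) * R w + R w = (R k - (m - 1)) * R w" by simp
  then show "ach (Block [Add a a w, Sub k k 3]) R' M' 2
      (\<lambda>R'' M''. (R'' k \<le> R k \<and> R'' = R(a := R a + (R k - R'' k) * R w, k := R'' k) \<and> M'' = M)
         \<and> R'' k < R' k)"
    unfolding R' by (intro ach_Block) (use assms m step in \<open>auto simp: fun_eq_iff\<close>)
qed (use assms in \<open>auto simp: fun_eq_iff\<close>)

text \<open>A pass costs four instructions, the test and the jump back. The time is linear in the
  quotient, which is a digit of a state in all uses, and not in the dividend.\<close>

lemma ach_divide:
  assumes "j \<notin> {3, 14, 17, 18}" "R 3 = 1" "R j = 0" "R 17 > 0"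
  shows "ach (divide j) R M (6 * (R 14 div R 17) + 4)
    (\<lambda>R' M'. R' = R(14 := R 14 mod R 17, j := R 14 div R 17, 18 := 0) \<and> M' = M)"
proof -
  define r W where "r = R 14" and "W = R 17"
  have W: "W > 0" using assms by (simp add: W_def)
  define st where "st k = R(14 := r - k * W, j := k, 18 := r - k * W + 1 - W)" for k
  have loop: "ach (Loop 18 (Block [Sub 14 14 17, Add j j 3, Add 18 14 3, Sub 18 18 17])) (st 0) M
      (6 * (r div W) + 2) (\<lambda>R' M'. R' = st (r div W) \<and> M' = M)"
  proof (rule ach_Loop[where f = "\<lambda>R'. R' 14 div W" and Tb = 4 and
      I = "\<lambda>R' M'. M' = M \<and> (\<exists>k. R' = st k \<and> k * W \<le> r)"])
    fix R' M' assume "M' = M \<and> (\<exists>k. R' = st k \<and> k * W \<le> r)" and pos: "0 < R' 18"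
    then obtain k where k: "R' = st k" "k * W \<le> r" "M' = M" by auto
    have ge: "r - k * W \<ge> W" using pos k(1) by (simp add: st_def)
    then have k': "Suc k * W \<le> r" using k(2) by simp
    have "blk [Sub 14 14 17, Add j j 3, Add 18 14 3, Sub 18 18 17] (st k) M
        (\<lambda>R'' M''. R'' = st (Suc k) \<and> M'' = M)"
      using assms by (auto simp: fun_eq_iff st_def W_def)
    then have "ach (Block [Sub 14 14 17, Add j j 3, Add 18 14 3, Sub 18 18 17]) (st k) M 4
        (\<lambda>R'' M''. R'' = st (Suc k) \<and> M'' = M)"
      by (rule ach_Block) simp
    then show "ach (Block [Sub 14 14 17, Add j j 3, Add 18 14 3, Sub 18 18 17]) R' M' 4
        (\<lambda>R'' M''. (M'' = M \<and> (\<exists>k. R'' = st k \<and> k * W \<le> r)) \<and> R'' 14 div W < R' 14 div W)"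
      unfolding k(1,3)
    proof (rule ach_mono)
      fix R'' M'' assume R'': "R'' = st (Suc k) \<and> M'' = M"
      have "(r - k * W - W) div W < (r - k * W) div W"
        using ge W by (metis le_div_geq lessI not_less)
      moreover have "r - Suc k * W = r - k * W - W" by simp
      ultimately have "st (Suc k) 14 div W < st k 14 div W"
        using assms(1) by (simp add: st_def)
      then show "(M'' = M \<and> (\<exists>k. R'' = st k \<and> k * W \<le> r)) \<and> R'' 14 div W < st k 14 div W"
        using R'' k' by blast
    qed simp
  next
    fix R' M' assume "M' = M \<and> (\<exists>k. R' = st k \<and> k * W \<le> r)" and z: "R' 18 = 0"
    then obtain k where k: "R' = st k" "k * W \<le> r" "M' = M" by auto
    have "r - k * W < W" using z k(1) by (simp add: st_def)
    then have "k = r div W" using k(2)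
      by (intro div_nat_eqI[symmetric]) (simp_all add: algebra_simps)
    then show "R' = st (r div W) \<and> M' = M" using k by simp
  next
    show "M = M \<and> (\<exists>k. st 0 = st k \<and> k * W \<le> r)" by (auto intro!: exI[of _ 0])
    show "st 0 14 div W * (4 + 2) + 2 \<le> 6 * (r div W) + 2" using assms by (simp add: st_def)
  qed
  have fin: "st (r div W) = R(14 := r mod W, j := r div W, 18 := 0)"
  proof -
    have "r - r div W * W = r mod W" by (rule minus_div_mult_eq_mod)
    moreover have "r mod W + 1 - W = 0" using W by (simp add: Suc_leI)
    ultimately show ?thesis by (simp add: st_def)
  qed
  have st0: "st 0 = R(18 := r + 1 - W)"
    using assms by (auto simp: st_def r_def fun_eq_iff)
  show ?thesis
    unfolding divide_def r_def[symmetric] W_def[symmetric]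
  proof (rule ach_Seq_Block)
    show "blk [Add 18 14 3, Sub 18 18 17] R M (\<lambda>R' M'. ach (Loop 18
        (Block [Sub 14 14 17, Add j j 3, Add 18 14 3, Sub 18 18 17])) R' M' (6 * (r div W) + 2)
        (\<lambda>R' M'. R' = R(14 := r mod W, j := r div W, 18 := 0) \<and> M' = M))"
      using loop unfolding fin st0 by (simp add: assms r_def W_def)
  qed simp
qed

text \<open>Splits the two leading digits off register 14 and adds to register 15 the change of the
  code caused by completing one more layer. A violated capacity clears register 11 and so ends the
  loop, because every larger \<open>h\<close> would complete this layer too.\<close>

definition layer_body :: com where
  "layer_body =
     Seq (Block [Sub 13 13 3, Load 17 13, Const 16 0]) (Seq (divide 16)
     (Seq (Block [Sub 19 7 16, Add 21 19 22]) (Seq (add_multiple 15 17 21)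
     (Seq (Block [Sub 13 13 3, Load 17 13, Const 20 0]) (Seq (divide 20)
     (Seq (Block [Add 15 15 17, Load 21 12, Add 12 12 3, Load 18 12, Add 12 12 3, Add 20 20 3,
        Sub 20 20 21, Sub 18 18 19, Add 20 20 18, Load 18 12, Add 12 12 3, Sub 18 19 18, Add 20 20 18])
     (Cond 20 (Block [Const 11 0, Const 16 1]) (Block [Store 15 3, Sub 11 11 3]))))))))"

text \<open>The two divisions take \<open>6 * n\<close> steps each and the multiplication
  \<open>4 * n\<close>; the constant covers the rest.\<close>

lemma ach_layer_body:
  fixes R M
  defines "W1 \<equiv> M (R 13 - 1)" and "W2 \<equiv> M (R 13 - 2)"
  defines "b \<equiv> R 14 div W1" and "c \<equiv> R 14 mod W1 div W2"
  defines "a \<equiv> R 15 + (R 7 - b) * W1 + W2"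
  defines "ok \<equiv> c < M (R 12) \<and> M (R 12 + 1) \<le> R 7 - b \<and> R 7 - b \<le> M (R 12 + 2)"
  assumes R: "R 3 = 1" "R 22 = 0" and W: "W1 > 0" "W2 > 0"
    and n: "b \<le> n" "c \<le> n" "R 7 \<le> n"
  shows "ach layer_body R M (16 * n + 40) (\<lambda>R' M'. (\<forall>j<11. R' j = R j) \<and> R' 22 = 0 \<and>
     R' 12 = R 12 + 3 \<and> R' 13 = R 13 - 2 \<and> R' 14 = R 14 mod W1 mod W2 \<and> R' 15 = a \<and>
     (if ok then R' 11 = R 11 - 1 \<and> R' 16 = b \<and> M' = M(a := 1)
      else R' 11 = 0 \<and> R' 16 = 1 \<and> M' = M))"
proof -
  define d where "d = R 7 - b"
  have d: "d \<le> n" using n by (simp add: d_def)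
  define R1 where "R1 = R(13 := R 13 - 1, 17 := W1, 16 := 0)"
  define R2 where "R2 = R1(14 := R 14 mod W1, 16 := b, 18 := 0)"
  define R3 where "R3 = R2(19 := d, 21 := d)"
  define R4 where "R4 = R3(15 := R 15 + d * W1, 21 := 0)"
  define R5 where "R5 = R4(13 := R 13 - 2, 17 := W2, 20 := 0)"
  define R6 where "R6 = R5(14 := R 14 mod W1 mod W2, 20 := c, 18 := 0)"
  \<comment> \<open>Each summand is the truncated amount by which one of the three conditions fails,
    so the sum vanishes exactly if all of them hold.\<close>
  define v where "v = (c + 1 - M (R 12)) + (M (R 12 + 1) - d) + (d - M (R 12 + 2))"
  define R7 where "R7 = R6(15 := a, 21 := M (R 12), 12 := R 12 + 3, 18 := d - M (R 12 + 2), 20 := v)"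
  have v: "v = 0 \<longleftrightarrow> ok" by (auto simp: v_def ok_def d_def)
  let ?c1 = "[Sub 13 13 3, Load 17 13, Const 16 0]"
  let ?c3 = "[Sub 19 7 16, Add 21 19 22]"
  let ?c5 = "[Sub 13 13 3, Load 17 13, Const 20 0]"
  let ?c7 = "[Add 15 15 17, Load 21 12, Add 12 12 3, Load 18 12, Add 12 12 3, Add 20 20 3,
        Sub 20 20 21, Sub 18 18 19, Add 20 20 18, Load 18 12, Add 12 12 3, Sub 18 19 18, Add 20 20 18]"
  let ?Q = "\<lambda>R' M'. (\<forall>j<11. R' j = R j) \<and> R' 22 = 0 \<and>
     R' 12 = R 12 + 3 \<and> R' 13 = R 13 - 2 \<and> R' 14 = R 14 mod W1 mod W2 \<and> R' 15 = a \<and>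
     (if ok then R' 11 = R 11 - 1 \<and> R' 16 = b \<and> M' = M(a := 1)
      else R' 11 = 0 \<and> R' 16 = 1 \<and> M' = M)"
  have c1: "ach (Block ?c1) R M 3 (\<lambda>R' M'. R' = R1 \<and> M' = M)"
    by (rule ach_Block) (use R in \<open>simp_all add: R1_def W1_def\<close>)
  have c2: "ach (divide 16) R1 M (6 * n + 4) (\<lambda>R' M'. R' = R2 \<and> M' = M)"
    by (rule ach_mono[OF ach_divide]) (use R W n in \<open>simp_all add: R1_def R2_def b_def\<close>)
  have c3: "ach (Block ?c3) R2 M 2 (\<lambda>R' M'. R' = R3 \<and> M' = M)"
    by (rule ach_Block) (use R in \<open>simp_all add: R1_def R2_def R3_def d_def\<close>)
  have c4: "ach (add_multiple 15 17 21) R3 M (4 * n + 2) (\<lambda>R' M'. R' = R4 \<and> M' = M)"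
    by (rule ach_mono[OF ach_add_multiple])
      (use R d in \<open>simp_all add: R1_def R2_def R3_def R4_def\<close>)
  have c5: "ach (Block ?c5) R4 M 3 (\<lambda>R' M'. R' = R5 \<and> M' = M)"
    by (rule ach_Block)
      (use R in \<open>simp_all add: R1_def R2_def R3_def R4_def R5_def W2_def fun_eq_iff numeral_2_eq_2\<close>)
  have c6: "ach (divide 20) R5 M (6 * n + 4) (\<lambda>R' M'. R' = R6 \<and> M' = M)"
    by (rule ach_mono[OF ach_divide])
      (use R W n in \<open>simp_all add: R1_def R2_def R3_def R4_def R5_def R6_def c_def\<close>)
  have c7: "ach (Block ?c7) R6 M 13 (\<lambda>R' M'. R' = R7 \<and> M' = M)"
    by (rule ach_Block)
      (use R in \<open>simp_all add: R1_def R2_def R3_def R4_def R5_def R6_def R7_def a_def d_def v_def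
        fun_eq_iff numeral_2_eq_2 numeral_3_eq_3\<close>)
  have c8: "ach (Cond 20 (Block [Const 11 0, Const 16 1]) (Block [Store 15 3, Sub 11 11 3])) R7 M 4 ?Q"
  proof (rule ach_Cond[where Tc = "2"])
    assume "0 < R7 20"
    then have "\<not> ok" using v by (simp add: R7_def)
    then show "ach (Block [Const 11 0, Const 16 1]) R7 M 2 ?Q"
      by (intro ach_Block) (use R in \<open>simp_all add: R1_def R2_def R3_def R4_def R5_def R6_def R7_def\<close>)
  next
    assume "R7 20 = 0"
    then have "ok" using v by (simp add: R7_def)
    then show "ach (Block [Store 15 3, Sub 11 11 3]) R7 M 2 ?Q"
      by (intro ach_Block) (use R in \<open>simp_all add: R1_def R2_def R3_def R4_def R5_def R6_def R7_def\<close>)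
  qed simp
  show ?thesis
    unfolding layer_body_def
    by (rule c1[THEN ach_Seq_det] c2[THEN ach_Seq_det] c3[THEN ach_Seq_det] c4[THEN ach_Seq_det]
        c5[THEN ach_Seq_det] c6[THEN ach_Seq_det] c7[THEN ach_Seq_det] c8 order_refl | simp)+
qed

section \<open>Scan states as numbers in base \<open>n\<close>\<close>

context layers
begin

text \<open>The pairs \<open>(b i, c i)\<close> for \<open>i = 1, \<dots>, lam\<close> are read as digits in base \<open>n\<close>, with the
  most significant ones from layer 1.\<close>

definition tail_code :: "(nat \<Rightarrow> nat) \<Rightarrow> (nat \<Rightarrow> nat) \<Rightarrow> nat \<Rightarrow> nat" where
  "tail_code b c i = (\<Sum>j\<in>{Suc i..lam}. b j * n ^ (2 * (lam - j) + 1) + c j * n ^ (2 * (lam - j)))"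

abbreviation code :: "(nat \<Rightarrow> nat) \<Rightarrow> (nat \<Rightarrow> nat) \<Rightarrow> nat" where
  "code b c \<equiv> tail_code b c 0"

lemma tail_code_top [simp]: "tail_code b c lam = 0"
  by (simp add: tail_code_def)

lemma tail_code_step:
  "i < lam \<Longrightarrow> tail_code b c i =
     b (Suc i) * n ^ (2 * (lam - Suc i) + 1) + c (Suc i) * n ^ (2 * (lam - Suc i)) + tail_code b c (Suc i)"
  unfolding tail_code_def by (subst sum.atLeast_Suc_atMost) auto

lemma digits_less:
  assumes "b < n" "c < n" "t < (n::nat) ^ m"
  shows "c * n ^ m + t < n ^ (m + 1)" "b * n ^ (m + 1) + c * n ^ m + t < n ^ (m + 2)"
proof -
  have "c * n ^ m + t < (c + 1) * n ^ m" using assms(3) by simp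
  also have "\<dots> \<le> n * n ^ m" using assms(2) by (intro mult_right_mono) auto
  finally show 1: "c * n ^ m + t < n ^ (m + 1)" by simp
  have "b * n ^ (m + 1) + c * n ^ m + t < (b + 1) * n ^ (m + 1)" using 1 by simp
  also have "\<dots> \<le> n * n ^ (m + 1)" using assms(1) by (intro mult_right_mono) auto
  finally show "b * n ^ (m + 1) + c * n ^ m + t < n ^ (m + 2)" by simp
qed

lemma tail_code_less:
  assumes "\<And>i. b i < n" "\<And>i. c i < n" "i \<le> lam"
  shows "tail_code b c i < n ^ (2 * (lam - i))"
  using assms(3)
proof (induction rule: inc_induct)
  case (step i)
  have "2 * (lam - i) = 2 * (lam - Suc i) + 2" using step.hyps by simp
  then show ?case
    using digits_less(2)[OF assms(1,2) step.IH, of "Suc i" "Suc i"] step.hyps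
    by (simp add: tail_code_step)
qed simp

text \<open>The digits behind a given one sum to less than its place value, so division and
  remainder meet no carry.\<close>

lemma tail_code_div:
  assumes "\<And>i. b i < n" "\<And>i. c i < n" "i < lam"
  defines "W1 \<equiv> n ^ (2 * (lam - Suc i) + 1)" and "W2 \<equiv> n ^ (2 * (lam - Suc i))"
  shows "tail_code b c i div W1 = b (Suc i)" "tail_code b c i mod W1 div W2 = c (Suc i)"
    "tail_code b c i mod W1 mod W2 = tail_code b c (Suc i)"
proof -
  have t: "tail_code b c (Suc i) < W2"
    unfolding W2_def using assms(1-3) by (intro tail_code_less) auto
  have u: "c (Suc i) * W2 + tail_code b c (Suc i) < W1"
    unfolding W1_def W2_def by (rule digits_less(1)[OF assms(1,2)]) (use t W2_def in simp_all)
  have eq: "tail_code b c i = b (Suc i) * W1 + (c (Suc i) * W2 + tail_code b c (Suc i))"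
    using tail_code_step[OF assms(3)] by (simp add: W1_def W2_def)
  show "tail_code b c i div W1 = b (Suc i)" unfolding eq using u by simp
  have m: "tail_code b c i mod W1 = c (Suc i) * W2 + tail_code b c (Suc i)" unfolding eq using u by simp
  show "tail_code b c i mod W1 div W2 = c (Suc i)" "tail_code b c i mod W1 mod W2 = tail_code b c (Suc i)"
    unfolding m using t by simp_all
qed

text \<open>Decoding from layer 1 upwards: equal tails have equal leading digits and equal next
  tails. The equality of the tails is part of the claim to make the induction work.\<close>

lemma tail_code_inj:
  assumes "\<And>i. b i < n" "\<And>i. c i < n" "\<And>i. b' i < n" "\<And>i. c' i < n"
    and "tail_code b c 0 = tail_code b' c' 0" "i \<le> lam"
  shows "tail_code b c i = tail_code b' c' i \<and> (\<forall>j\<in>{1..i}. b j = b' j \<and> c j = c' j)"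
  using assms(6)
proof (induction i)
  case 0
  then show ?case using assms(5) by simp
next
  case (Suc i)
  then have eq: "tail_code b c i = tail_code b' c' i" and i: "i < lam" by auto
  note d = tail_code_div[of b c i, OF assms(1,2) i] and d' = tail_code_div[of b' c' i, OF assms(3,4) i]
  show ?case using d d' eq Suc by (auto simp: le_Suc_eq)
qed

text \<open>This is what makes the entries of a state digits in base \<open>n\<close>.\<close>

lemma reach_less: "reach p b c \<Longrightarrow> p \<le> n \<Longrightarrow> b i < n \<and> c i < n"
  using reach_bounds[of p b c] by (meson order_less_le_trans)

lemma reach_code_less: "reach p b c \<Longrightarrow> p \<le> n \<Longrightarrow> code b c < n ^ (2 * lam)"
  using tail_code_less[of b c 0] reach_less by simp

text \<open>The code determines the layers \<open>1, ..., lam\<close>, and the position determines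
  the others. At a fixed position, one mark thus stands for one state.\<close>

lemma reach_code_inj:
  assumes "reach p b c" "reach p b' c'" "p \<le> n" "code b c = code b' c'"
  shows "b = b' \<and> c = c'"
proof -
  have "\<forall>j\<in>{1..lam}. b j = b' j \<and> c j = c' j"
    using tail_code_inj[of b c b' c' lam] reach_less assms by blast
  moreover have "b 0 = b' 0" "c 0 = c' 0" "\<forall>i>lam. b i = b' i \<and> c i = c' i"
    using reach_outside[OF assms(1)] reach_outside[OF assms(2)] by auto
  ultimately have "b i = b' i \<and> c i = c' i" for i
    by (cases "i = 0"; cases "i \<le> lam") auto
  then show ?thesis by auto
qed

text \<open>Layer 0 has no digits, so the successor for \<open>h = 0\<close> has the same code one
  row further.\<close>

lemma code_next_0: "code (next_start 0 p b) (next_count 0 c) = code b c"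
  unfolding tail_code_def by (intro sum.cong) (auto simp: next_start_def next_count_def)

text \<open>Raising \<open>h\<close> by one changes two digits only: the first leaf of layer
  \<open>Suc i\<close> rises to \<open>p\<close>, and its count grows by 1. Both changes are
  nonnegative, so additions suffice to update the address.\<close>

lemma code_next_Suc:
  assumes "i < lam" "b (Suc i) \<le> p"
  shows "code (next_start (Suc i) p b) (next_count (Suc i) c) =
    code (next_start i p b) (next_count i c)
      + (p - b (Suc i)) * n ^ (2 * (lam - Suc i) + 1) + n ^ (2 * (lam - Suc i))"
proof -
  have mem: "Suc i \<in> {Suc 0..lam}" using assms by simp
  have rest: "(\<Sum>j\<in>{Suc 0..lam} - {Suc i}. next_start (Suc i) p b j * n ^ (2 * (lam - j) + 1)
        + next_count (Suc i) c j * n ^ (2 * (lam - j)))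
      = (\<Sum>j\<in>{Suc 0..lam} - {Suc i}. next_start i p b j * n ^ (2 * (lam - j) + 1)
        + next_count i c j * n ^ (2 * (lam - j)))"
    by (intro sum.cong) (auto simp: next_start_def next_count_def le_Suc_eq)
  have "p * n ^ (2 * (lam - Suc i) + 1)
      = b (Suc i) * n ^ (2 * (lam - Suc i) + 1) + (p - b (Suc i)) * n ^ (2 * (lam - Suc i) + 1)"
    using assms(2) by (simp flip: distrib_right)
  then show ?thesis
    unfolding tail_code_def sum.remove[OF finite_atLeastAtMost mem] rest
    by (simp add: next_start_def next_count_def)
qed

text \<open>The instance occupies the addresses up to \<open>3 * lam + 1\<close>, followed by the powers of \<open>n\<close>
  up to \<open>n ^ (2 * lam)\<close>. The table of the reached states starts at \<open>5 * lam + 3\<close>.\<close>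

definition tables :: "(nat \<Rightarrow> nat) \<Rightarrow> bool" where
  "tables M \<longleftrightarrow> (\<forall>i\<in>{1..lam}. M (3 * i - 1) = N i \<and> M (3 * i) = L i \<and> M (3 * i + 1) = U i) \<and>
     (\<forall>j\<le>2 * lam. M (3 * lam + 2 + j) = n ^ j)"

lemma tables_cong:
  assumes "tables M" "\<And>j. j < 5 * lam + 3 \<Longrightarrow> M' j = M j"
  shows "tables M'"
  unfolding tables_def
proof (intro conjI ballI allI impI)
  fix i assume "i \<in> {1..lam}"
  then show "M' (3 * i - 1) = N i" "M' (3 * i) = L i" "M' (3 * i + 1) = U i"
    using assms(1) assms(2)[of "3 * i - 1"] assms(2)[of "3 * i"] assms(2)[of "3 * i + 1"]
    unfolding tables_def by auto
next
  fix j assume "j \<le> 2 * lam"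
  then show "M' (3 * lam + 2 + j) = n ^ j"
    using assms(1) assms(2)[of "3 * lam + 2 + j"] unfolding tables_def by auto
qed

section \<open>Marking the successors of one state\<close>

definition successor_code :: "nat \<Rightarrow> (nat \<Rightarrow> nat) \<Rightarrow> (nat \<Rightarrow> nat) \<Rightarrow> nat \<Rightarrow> nat \<Rightarrow> bool" where
  "successor_code p b c i y \<longleftrightarrow> (\<exists>h\<le>i. (\<forall>j\<in>{1..h}. complete_ok p b c j) \<and>
     y = code (next_start h p b) (next_count h c))"

definition marked :: "(nat \<Rightarrow> bool) \<Rightarrow> nat \<Rightarrow> (nat \<Rightarrow> nat) \<Rightarrow> nat \<Rightarrow> nat" where
  "marked S base M y = (if y \<ge> base \<and> S (y - base) then 1 else M y)"

text \<open>The invariant has two modes. As long as layers remain, or once all have passed, the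
  registers describe the state after layer \<open>i\<close>; otherwise layer \<open>Suc i\<close>
  has failed, register 11 is 0 and register 16 records the failure.\<close>

definition layer_inv ::
  "nat \<Rightarrow> (nat \<Rightarrow> nat) \<Rightarrow> (nat \<Rightarrow> nat) \<Rightarrow> nat \<Rightarrow> (nat \<Rightarrow> nat) \<Rightarrow> (nat \<Rightarrow> nat) \<Rightarrow> nat \<Rightarrow>
     (nat \<Rightarrow> nat) \<Rightarrow> (nat \<Rightarrow> nat) \<Rightarrow> bool" where
  "layer_inv p b c base R0 M0 i R M \<longleftrightarrow> i \<le> lam \<and> (\<forall>j<11. R j = R0 j) \<and> R 22 = 0 \<and>
     (\<forall>j\<in>{1..i}. complete_ok p b c j) \<and> M = marked (successor_code p b c i) base M0 \<and>
     (if R 11 > 0 \<or> i = lam then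
        R 11 = lam - i \<and> R 12 = 3 * i + 2 \<and> R 13 = 5 * lam + 2 - 2 * i \<and> R 14 = tail_code b c i \<and>
        R 15 = base + code (next_start i p b) (next_count i c) \<and> R 16 = b i
      else R 16 = 1 \<and> \<not> complete_ok p b c (Suc i))"

lemma ach_layer_step:
  assumes inv: "layer_inv p b c base R0 M0 i R M" and pos: "R 11 > 0"
    and r: "reach p b c" "p \<le> n" and tab: "tables M0" "base \<ge> 5 * lam + 3" and R0: "R0 3 = 1" "R0 7 = p"
  shows "ach layer_body R M (16 * n + 40) (\<lambda>R' M'. (\<exists>i. layer_inv p b c base R0 M0 i R' M') \<and> R' 11 < R 11)"
proof -
  have i: "i < lam" and R: "\<And>j. j < 11 \<Longrightarrow> R j = R0 j" "R 22 = 0"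
    and sofar: "\<forall>j\<in>{1..i}. complete_ok p b c j"
    and M: "M = marked (successor_code p b c i) base M0"
    and R': "R 11 = lam - i" "R 12 = 3 * i + 2" "R 13 = 5 * lam + 2 - 2 * i" "R 14 = tail_code b c i"
        "R 15 = base + code (next_start i p b) (next_count i c)" "R 16 = b i"
    using inv pos unfolding layer_inv_def by (auto split: if_splits)
  define W1 W2 where "W1 = n ^ (2 * (lam - Suc i) + 1)" and "W2 = n ^ (2 * (lam - Suc i))"
  have n: "n > 0" using r reach_bounds by fastforce
  have bc: "\<And>i. b i < n" "\<And>i. c i < n" using reach_less[OF r] by auto
  have bp: "b (Suc i) \<le> p" using reach_bounds[OF r(1)] by (simp add: less_imp_le)
  have low: "M j = M0 j" if "j < 5 * lam + 3" for j
    using that tab(2) unfolding M marked_def by simp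
  have tabM: "tables M" by (rule tables_cong[OF tab(1) low])
  \<comment> \<open>The pointer is decremented before each load, so the place value of the first
    leaf is fetched first and that of the count second.\<close>
  have a1: "R 13 - 1 = 3 * lam + 2 + (2 * (lam - Suc i) + 1)"
    and a2: "R 13 - 2 = 3 * lam + 2 + 2 * (lam - Suc i)" using R'(3) i by auto
  have pow: "M (3 * lam + 2 + j) = n ^ j" if "j \<le> 2 * lam" for j
    using tabM that unfolding tables_def by blast
  have Mw: "M (R 13 - 1) = W1" "M (R 13 - 2) = W2"
    unfolding a1 a2 W1_def W2_def by (rule pow, use i in simp)+
  have "Suc i \<in> {1..lam}" using i by simp
  then have "M (3 * Suc i - 1) = N (Suc i)" "M (3 * Suc i) = L (Suc i)" "M (3 * Suc i + 1) = U (Suc i)"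
    using tabM unfolding tables_def by blast+
  moreover have "3 * Suc i - 1 = R 12" "3 * Suc i = R 12 + 1" "3 * Suc i + 1 = R 12 + 2"
    using R'(2) by simp_all
  ultimately have capi: "M (R 12) = N (Suc i)" "M (R 12 + 1) = L (Suc i)" "M (R 12 + 2) = U (Suc i)"
    by (simp_all only:)
  have R37: "R 3 = 1" "R 7 = p" using R(1) R0 by simp_all
  have Wpos: "W1 > 0" "W2 > 0" using n by (simp_all add: W1_def W2_def)
  have dv: "R 14 div W1 = b (Suc i)" "R 14 mod W1 div W2 = c (Suc i)"
      "R 14 mod W1 mod W2 = tail_code b c (Suc i)"
    unfolding R'(4) W1_def W2_def using tail_code_div[of b c i, OF bc i] by simp_all
  have addr: "R 15 + (p - b (Suc i)) * W1 + W2 = base + code (next_start (Suc i) p b) (next_count (Suc i) c)"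
    unfolding R'(5) W1_def W2_def using code_next_Suc[of i b p c] i bp by simp
  have ok: "complete_ok p b c (Suc i) \<longleftrightarrow>
      c (Suc i) < M (R 12) \<and> M (R 12 + 1) \<le> p - b (Suc i) \<and> p - b (Suc i) \<le> M (R 12 + 2)"
    unfolding capi complete_ok_def by auto
  have "ach layer_body R M (16 * n + 40) (\<lambda>R' M'. (\<forall>j<11. R' j = R j) \<and> R' 22 = 0 \<and>
     R' 12 = R 12 + 3 \<and> R' 13 = R 13 - 2 \<and> R' 14 = tail_code b c (Suc i) \<and>
     R' 15 = base + code (next_start (Suc i) p b) (next_count (Suc i) c) \<and>
     (if complete_ok p b c (Suc i) then R' 11 = R 11 - 1 \<and> R' 16 = b (Suc i) \<and>
        M' = M(base + code (next_start (Suc i) p b) (next_count (Suc i) c) := 1)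
      else R' 11 = 0 \<and> R' 16 = 1 \<and> M' = M))"
    using ach_layer_body[of R M n] bc[of "Suc i"] r(2) R(2) Wpos
    unfolding Mw R37 dv addr ok by simp
  then show ?thesis
  proof (rule ach_mono)
    fix R1 M1 assume post: "(\<forall>j<11. R1 j = R j) \<and> R1 22 = 0 \<and>
     R1 12 = R 12 + 3 \<and> R1 13 = R 13 - 2 \<and> R1 14 = tail_code b c (Suc i) \<and>
     R1 15 = base + code (next_start (Suc i) p b) (next_count (Suc i) c) \<and>
     (if complete_ok p b c (Suc i) then R1 11 = R 11 - 1 \<and> R1 16 = b (Suc i) \<and>
        M1 = M(base + code (next_start (Suc i) p b) (next_count (Suc i) c) := 1)
      else R1 11 = 0 \<and> R1 16 = 1 \<and> M1 = M)"
    show "(\<exists>i. layer_inv p b c base R0 M0 i R1 M1) \<and> R1 11 < R 11"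
    proof (cases "complete_ok p b c (Suc i)")
      case True
      have S: "successor_code p b c (Suc i) y \<longleftrightarrow> successor_code p b c i y \<or>
          y = code (next_start (Suc i) p b) (next_count (Suc i) c)" for y
      proof -
        have all: "\<forall>j\<in>{1..Suc i}. complete_ok p b c j" using sofar True by (auto simp: le_Suc_eq)
        show ?thesis
        proof
          assume "successor_code p b c (Suc i) y"
          then show "successor_code p b c i y \<or> y = code (next_start (Suc i) p b) (next_count (Suc i) c)"
            unfolding successor_code_def by (metis le_Suc_eq)
        next
          assume "successor_code p b c i y \<or> y = code (next_start (Suc i) p b) (next_count (Suc i) c)"
          then show "successor_code p b c (Suc i) y"
            using all unfolding successor_code_def by (metis le_Suc_eq order_refl)
        qed
      qed
      have "M1 = marked (successor_code p b c (Suc i)) base M0"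
        using post True unfolding M by (auto simp: fun_eq_iff marked_def S)
      moreover have "\<forall>j\<in>{1..Suc i}. complete_ok p b c j" using sofar True by (auto simp: le_Suc_eq)
      ultimately have "layer_inv p b c base R0 M0 (Suc i) R1 M1"
        unfolding layer_inv_def using post True i R R' by auto
      then show ?thesis using post True pos by auto
    next
      case False
      have "layer_inv p b c base R0 M0 i R1 M1"
        unfolding layer_inv_def using post False i R M sofar by auto
      then show ?thesis using post False pos by auto
    qed
  qed simp
qed

end

text \<open>The mark stored before the loop is the successor for \<open>h = 0\<close>, which is
  subject to no check. Adding register 4 to the address of the current mark moves to the next
  row.\<close>

definition visit :: com where
  "visit = Seq (Block [Add 14 9 22, Add 15 10 4, Store 15 3, Add 13 5 22, Const 12 2, Add 11 2 22, Sub 16 7 3])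
     (Seq (Loop 11 layer_body) (Cond 16 (Block []) (Block [Const 0 1])))"

definition sweep_body :: com where
  "sweep_body = Seq (Block [Load 18 10]) (Seq (Cond 18 visit (Block [])) (Block [Add 9 9 3, Add 10 10 3, Sub 8 8 3]))"

text \<open>Register 10 is not reset, since the end of one row is the start of the next. The output
  is cleared at every position, so that only acceptance at the last one survives.\<close>

definition main_body :: com where
  "main_body = Seq (Block [Sub 6 6 3, Add 7 7 3, Const 0 0, Add 8 4 22, Const 9 0]) (Loop 8 sweep_body)"

text \<open>Registers 0 and 3, with the values 0 and 1, double as the addresses of
  \<open>lam\<close> and \<open>n\<close>. The last store marks the initial state, whose code is
  0.\<close>

definition prepare :: com where
  "prepare = Seq (Block [Load 2 0, Const 3 1, Load 1 3, Add 18 2 2, Add 5 18 2, Add 5 5 3, Add 5 5 3, Const 4 1, Store 5 3])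
     (Seq (Loop 18 (Seq (Block [Add 21 1 22, Const 17 0]) (Seq (add_multiple 17 4 21)
        (Block [Add 4 17 22, Add 5 5 3, Store 5 4, Sub 18 18 3]))))
     (Block [Add 10 5 3, Store 10 3, Const 7 0, Add 6 1 22]))"

definition clt_program :: com where
  "clt_program = Seq prepare (Loop 6 main_body)"

context layers
begin

abbreviation layer_time :: nat where
  "layer_time \<equiv> lam * (16 * n + 42)"

lemma ach_visit:
  assumes r: "reach p b c" "p \<le> n" and tab: "tables M" and A: "A \<ge> 5 * lam + 3"
    and R: "R 2 = lam" "R 3 = 1" "R 4 = n ^ (2 * lam)" "R 5 = 5 * lam + 2" "R 7 = p"
      "R 9 = code b c" "R 10 = A + code b c" "R 22 = 0"
  shows "ach visit R M (layer_time + 13) (\<lambda>R' M'. (\<forall>j\<in>{1..10}. R' j = R j) \<and> R' 22 = 0 \<and>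
    R' 0 = (if accepting p b c then 1 else R 0) \<and>
    M' = marked (successor_code p b c lam) (A + n ^ (2 * lam)) M)"
proof -
  define base where "base = A + n ^ (2 * lam)"
  have p1: "p \<ge> 1" using reach_bounds[OF r(1)] by simp
  have b0: "b 0 = p - 1" using reach_outside[OF r(1)] by simp
  define R1 where "R1 = R(14 := code b c, 15 := base + code b c, 13 := 5 * lam + 2, 12 := 2, 11 := lam, 16 := p - 1)"
  define M1 where "M1 = M(base + code b c := 1)"
  have init: "blk [Add 14 9 22, Add 15 10 4, Store 15 3, Add 13 5 22, Const 12 2, Add 11 2 22, Sub 16 7 3]
     R M (\<lambda>R' M'. R' = R1 \<and> M' = M1)"
    using R by (simp add: R1_def M1_def base_def add.assoc add.commute[of "code b c"])
  have S0: "successor_code p b c 0 y \<longleftrightarrow> y = code b c" for y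
    unfolding successor_code_def by (simp add: code_next_0)
  have inv0: "layer_inv p b c base R M 0 R1 M1"
    unfolding layer_inv_def
    using R b0 by (auto simp: R1_def M1_def marked_def S0 code_next_0 fun_eq_iff)
  have loop: "ach (Loop 11 layer_body) R1 M1 (layer_time + 2) (\<lambda>R' M'. (\<forall>j<11. R' j = R j) \<and> R' 22 = 0 \<and>
      (R' 16 = 0 \<longleftrightarrow> accepting p b c) \<and> M' = marked (successor_code p b c lam) base M)"
  proof (rule ach_Loop[where f = "\<lambda>R'. R' 11" and Tb = "16 * n + 40" and
      I = "\<lambda>R' M'. \<exists>i. layer_inv p b c base R M i R' M'"])
    show "\<exists>i. layer_inv p b c base R M i R1 M1" using inv0 by blast
    show "R1 11 * (16 * n + 40 + 2) + 2 \<le> layer_time + 2" by (simp add: R1_def)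
  next
    fix R' M' assume "\<exists>i. layer_inv p b c base R M i R' M'" "R' 11 > 0"
    then show "ach layer_body R' M' (16 * n + 40)
        (\<lambda>R'' M''. (\<exists>i. layer_inv p b c base R M i R'' M'') \<and> R'' 11 < R' 11)"
      using ach_layer_step r tab A R unfolding base_def by fastforce
  next
    fix R' M' assume "\<exists>i. layer_inv p b c base R M i R' M'" and z: "R' 11 = 0"
    then obtain i where inv: "layer_inv p b c base R M i R' M'" by blast
    show "(\<forall>j<11. R' j = R j) \<and> R' 22 = 0 \<and> (R' 16 = 0 \<longleftrightarrow> accepting p b c) \<and>
        M' = marked (successor_code p b c lam) base M"
    proof (cases "i = lam")
      case True
      then show ?thesis using inv unfolding layer_inv_def accepting_def by auto
    next
      case False
      then have bad: "i < lam" "R' 16 = 1" "\<not> complete_ok p b c (Suc i)"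
        using inv z unfolding layer_inv_def by auto
      \<comment> \<open>The loop stopped early at layer \<open>Suc i\<close>. Any \<open>h\<close>
        beyond \<open>i\<close> would require that layer to pass, so no successor has been
        missed.\<close>
      have "successor_code p b c i = successor_code p b c lam"
      proof (rule ext)
        fix y
        have "h \<le> i" if "\<forall>j\<in>{1..h}. complete_ok p b c j" for h
        proof (rule ccontr)
          assume "\<not> h \<le> i"
          then have "Suc i \<in> {1..h}" by simp
          then show False using bad(3) that by blast
        qed
        moreover from bad(1) have "h \<le> lam" if "h \<le> i" for h using that by simp
        ultimately show "successor_code p b c i y = successor_code p b c lam y"
          unfolding successor_code_def by blast
      qed
      moreover have "\<not> accepting p b c" using bad unfolding accepting_def by auto
      ultimately show ?thesis using inv bad unfolding layer_inv_def by auto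
    qed
  qed
  have fin: "ach (Cond 16 (Block []) (Block [Const 0 1])) R2 M2 3 (\<lambda>R' M'. (\<forall>j\<in>{1..10}. R' j = R j) \<and> R' 22 = 0 \<and>
      R' 0 = (if accepting p b c then 1 else R 0) \<and> M' = marked (successor_code p b c lam) base M)"
    if "(\<forall>j<11. R2 j = R j) \<and> R2 22 = 0 \<and>
      (R2 16 = 0 \<longleftrightarrow> accepting p b c) \<and> M2 = marked (successor_code p b c lam) base M" for R2 M2
    by (rule ach_Cond[where Tc = 1]) (use that in \<open>auto intro!: ach_Block\<close>)
  have "ach (Seq (Loop 11 layer_body) (Cond 16 (Block []) (Block [Const 0 1]))) R1 M1 (layer_time + 5)
     (\<lambda>R' M'. (\<forall>j\<in>{1..10}. R' j = R j) \<and> R' 22 = 0 \<and>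
      R' 0 = (if accepting p b c then 1 else R 0) \<and> M' = marked (successor_code p b c lam) base M)"
    by (rule ach_Seq[OF ach_mono[OF loop order_refl fin]]) simp_all
  from ach_Seq_det[OF ach_Block[OF init order_refl] this, of "layer_time + 13"] show ?thesis
    unfolding visit_def base_def[symmetric] by simp
qed

section \<open>Sweeping over the states at one position\<close>

definition state_code :: "nat \<Rightarrow> nat \<Rightarrow> bool" where
  "state_code p s \<longleftrightarrow> (\<exists>b c. reach p b c \<and> code b c = s)"

definition successors_upto :: "nat \<Rightarrow> nat \<Rightarrow> nat \<Rightarrow> bool" where
  "successors_upto p s y \<longleftrightarrow> (\<exists>b c. reach p b c \<and> code b c < s \<and> successor_code p b c lam y)"

definition accepting_upto :: "nat \<Rightarrow> nat \<Rightarrow> bool" where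
  "accepting_upto p s \<longleftrightarrow> (\<exists>b c. reach p b c \<and> code b c < s \<and> accepting p b c)"

abbreviation num_states :: nat where
  "num_states \<equiv> n ^ (2 * lam)"

text \<open>Marks are written to the next row only, so the row being read, like everything before
  it, is still that of \<open>M0\<close>.\<close>

definition sweep_inv ::
  "nat \<Rightarrow> nat \<Rightarrow> (nat \<Rightarrow> nat) \<Rightarrow> (nat \<Rightarrow> nat) \<Rightarrow> nat \<Rightarrow> (nat \<Rightarrow> nat) \<Rightarrow> (nat \<Rightarrow> nat) \<Rightarrow> bool" where
  "sweep_inv p A R0 M0 s R M \<longleftrightarrow> s \<le> num_states \<and> (\<forall>j\<in>{1..7}. R j = R0 j) \<and> R 22 = 0 \<and>
     R 8 = num_states - s \<and> R 9 = s \<and> R 10 = A + s \<and> R 0 = (if accepting_upto p s then 1 else 0) \<and>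
     (\<forall>j<A + num_states. M j = M0 j) \<and>
     (\<forall>y. M (A + num_states + y) > 0 \<longleftrightarrow> successors_upto p s y)"

lemma ach_sweep_step:
  assumes inv: "sweep_inv p A R0 M0 s R M" and pos: "R 8 > 0" and p: "p \<le> n"
    and tab: "tables M0" and A: "A \<ge> 5 * lam + 3"
    and marks: "\<And>s. s < num_states \<Longrightarrow> M0 (A + s) > 0 \<longleftrightarrow> state_code p s"
    and R0: "R0 2 = lam" "R0 3 = 1" "R0 4 = num_states" "R0 5 = 5 * lam + 2" "R0 7 = p"
  shows "ach sweep_body R M (layer_time + 19)
    (\<lambda>R' M'. (\<exists>s. sweep_inv p A R0 M0 s R' M') \<and> R' 8 < R 8)"
proof -
  have s: "s < num_states" and R: "\<And>j. j \<in> {1..7} \<Longrightarrow> R j = R0 j" "R 22 = 0" "R 8 = num_states - s"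
      "R 9 = s" "R 10 = A + s" "R 0 = (if accepting_upto p s then 1 else 0)"
    and M: "\<And>j. j < A + num_states \<Longrightarrow> M j = M0 j"
      "\<And>y. M (A + num_states + y) > 0 \<longleftrightarrow> successors_upto p s y"
    using inv pos unfolding sweep_inv_def by auto
  define R1 where "R1 = R(18 := M (A + s))"
  have load: "blk [Load 18 10] R M (\<lambda>R' M'. R' = R1 \<and> M' = M)"
    using R by (simp add: R1_def)
  have present: "M (A + s) > 0 \<longleftrightarrow> state_code p s" using M(1) marks s by simp
  have adv: "ach (Block [Add 9 9 3, Add 10 10 3, Sub 8 8 3]) R2 M2 3
      (\<lambda>R' M'. (\<exists>s. sweep_inv p A R0 M0 s R' M') \<and> R' 8 < R 8)"
    if "\<forall>j\<in>{1..10}. R2 j = R j" "R2 22 = 0" "R2 0 = (if accepting_upto p (Suc s) then 1 else 0)"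
      "\<And>j. j < A + num_states \<Longrightarrow> M2 j = M j"
      "\<And>y. M2 (A + num_states + y) > 0 \<longleftrightarrow> successors_upto p (Suc s) y" for R2 M2
  proof (rule ach_Block)
    have R2: "R2 3 = 1" "R2 8 = num_states - s" "R2 9 = s" "R2 10 = A + s"
      using that(1) R R0 by simp_all
    define R3 where "R3 = R2(9 := s + 1, 10 := A + s + 1, 8 := num_states - s - 1)"
    have "\<forall>j\<in>{1..7}. R2 j = R0 j" using that(1) R(1) by simp
    then have "\<forall>j\<in>{1..7}. R3 j = R0 j" by (simp add: R3_def)
    then have "sweep_inv p A R0 M0 (Suc s) R3 M2"
      unfolding sweep_inv_def using that s M by (simp add: R3_def)
    moreover have "R3 8 < R 8" using s R by (simp add: R3_def)
    ultimately show "blk [Add 9 9 3, Add 10 10 3, Sub 8 8 3] R2 M2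
        (\<lambda>R' M'. (\<exists>s. sweep_inv p A R0 M0 s R' M') \<and> R' 8 < R 8)"
      using R2 unfolding R3_def by auto
  qed simp
  have body: "ach (Seq (Cond 18 visit (Block [])) (Block [Add 9 9 3, Add 10 10 3, Sub 8 8 3])) R1 M
      (layer_time + 18) (\<lambda>R' M'. (\<exists>s. sweep_inv p A R0 M0 s R' M') \<and> R' 8 < R 8)"
  proof (rule ach_Seq[where Tc = "layer_time + 15" and Td = 3], rule ach_Cond[where Tc = "layer_time + 13"])
    assume "0 < R1 18"
    then obtain b c where bc: "reach p b c" "code b c = s"
      using present by (auto simp: R1_def state_code_def)
    \<comment> \<open>Only one state has the code \<open>s\<close>, so visiting it accounts for
      every successor and every acceptance that raising the bound to \<open>Suc s\<close>
      adds.\<close>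
    have uniq: "b' = b \<and> c' = c" if "reach p b' c'" "code b' c' = s" for b' c'
      using reach_code_inj[OF that(1) bc(1) p] that(2) bc(2) by simp
    have S: "successors_upto p (Suc s) y \<longleftrightarrow> successors_upto p s y \<or> successor_code p b c lam y" for y
      unfolding successors_upto_def less_Suc_eq using bc uniq by blast
    have Acc: "accepting_upto p (Suc s) \<longleftrightarrow> accepting_upto p s \<or> accepting p b c"
      unfolding accepting_upto_def less_Suc_eq using bc uniq by blast
    have tabM: "tables M" by (rule tables_cong[OF tab]) (use M(1) A in simp)
    have "ach visit R1 M (layer_time + 13) (\<lambda>R' M'. (\<forall>j\<in>{1..10}. R' j = R1 j) \<and> R' 22 = 0 \<and>
        R' 0 = (if accepting p b c then 1 else R1 0) \<and>
        M' = marked (successor_code p b c lam) (A + num_states) M)"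
      by (rule ach_visit[OF bc(1) p tabM A]) (use R R0 bc in \<open>simp_all add: R1_def\<close>)
    then show "ach visit R1 M (layer_time + 13) (\<lambda>R' M'. ach (Block [Add 9 9 3, Add 10 10 3, Sub 8 8 3]) R' M' 3
        (\<lambda>R' M'. (\<exists>s. sweep_inv p A R0 M0 s R' M') \<and> R' 8 < R 8))"
    proof (rule ach_mono)
      fix R2 M2 assume post: "(\<forall>j\<in>{1..10}. R2 j = R1 j) \<and> R2 22 = 0 \<and>
        R2 0 = (if accepting p b c then 1 else R1 0) \<and>
        M2 = marked (successor_code p b c lam) (A + num_states) M"
      show "ach (Block [Add 9 9 3, Add 10 10 3, Sub 8 8 3]) R2 M2 3
        (\<lambda>R' M'. (\<exists>s. sweep_inv p A R0 M0 s R' M') \<and> R' 8 < R 8)"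
      proof (rule adv)
        show "\<forall>j\<in>{1..10}. R2 j = R j" "R2 22 = 0" using post by (simp_all add: R1_def)
        show "R2 0 = (if accepting_upto p (Suc s) then 1 else 0)"
          using post R(6) by (simp add: R1_def Acc)
        show "M2 j = M j" if "j < A + num_states" for j
          using post that by (simp add: marked_def)
        show "M2 (A + num_states + y) > 0 \<longleftrightarrow> successors_upto p (Suc s) y" for y
          using post M(2)[of y] by (simp add: marked_def S)
      qed
    qed simp
  next
    assume "R1 18 = 0"
    then have none: "\<And>b c. reach p b c \<Longrightarrow> code b c \<noteq> s"
      using present by (auto simp: R1_def state_code_def)
    have S: "successors_upto p (Suc s) y \<longleftrightarrow> successors_upto p s y" for y
      unfolding successors_upto_def less_Suc_eq using none by blast
    have Acc: "accepting_upto p (Suc s) \<longleftrightarrow> accepting_upto p s"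
      unfolding accepting_upto_def less_Suc_eq using none by blast
    show "ach (Block []) R1 M (layer_time + 13) (\<lambda>R' M'. ach (Block [Add 9 9 3, Add 10 10 3, Sub 8 8 3]) R' M' 3
        (\<lambda>R' M'. (\<exists>s. sweep_inv p A R0 M0 s R' M') \<and> R' 8 < R 8))"
    proof (rule ach_Block)
      have "ach (Block [Add 9 9 3, Add 10 10 3, Sub 8 8 3]) R1 M 3
        (\<lambda>R' M'. (\<exists>s. sweep_inv p A R0 M0 s R' M') \<and> R' 8 < R 8)"
        by (rule adv) (simp_all add: R1_def R Acc S M)
      then show "blk [] R1 M (\<lambda>R' M'. ach (Block [Add 9 9 3, Add 10 10 3, Sub 8 8 3]) R' M' 3
        (\<lambda>R' M'. (\<exists>s. sweep_inv p A R0 M0 s R' M') \<and> R' 8 < R 8))" by simp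
    qed simp
  qed simp_all
  from ach_Seq_det[OF ach_Block[OF load order_refl] this, of "layer_time + 19"] show ?thesis
    unfolding sweep_body_def by simp
qed

section \<open>Running through the positions\<close>

abbreviation sweep_time :: nat where
  "sweep_time \<equiv> num_states * (layer_time + 21)"

text \<open>\<open>p\<close> counts the finished sweeps, so row \<open>p\<close> holds the marks of
  position \<open>Suc p\<close>. The output is constrained only after the sweep of position
  \<open>n\<close>; for \<open>n = 0\<close> it is the initial 0, and no state exists.\<close>

definition main_inv :: "nat \<Rightarrow> (nat \<Rightarrow> nat) \<Rightarrow> (nat \<Rightarrow> nat) \<Rightarrow> bool" where
  "main_inv p R M \<longleftrightarrow> p \<le> n \<and> R 2 = lam \<and> R 3 = 1 \<and> R 4 = num_states \<and> R 5 = 5 * lam + 2 \<and>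
     R 6 = n - p \<and> R 7 = p \<and> R 22 = 0 \<and> R 10 = 5 * lam + 3 + p * num_states \<and> tables M \<and>
     (\<forall>y. M (5 * lam + 3 + p * num_states + y) > 0 \<longleftrightarrow> state_code (Suc p) y) \<and>
     (p = n \<longrightarrow> R 0 = (if \<exists>b c. reach n b c \<and> accepting n b c then 1 else 0))"

text \<open>Position \<open>Suc p\<close> is not the initial one, so every state there arises by a
  step, and its predecessor has a code below \<open>num_states\<close>.\<close>

lemma state_code_Suc:
  assumes "p \<le> n" "1 \<le> p"
  shows "state_code (Suc p) y \<longleftrightarrow> successors_upto p num_states y"
proof
  assume "state_code (Suc p) y"
  then obtain b' c' where "reach (Suc p) b' c'" "y = code b' c'" by (auto simp: state_code_def)
  then show "successors_upto p num_states y"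
  proof (cases rule: reach.cases)
    case (step b c h)
    then show ?thesis using \<open>y = code b' c'\<close> reach_code_less[of p b c] assms
      unfolding successors_upto_def successor_code_def by auto
  qed (use assms in simp)
next
  assume "successors_upto p num_states y"
  then show "state_code (Suc p) y"
    unfolding successors_upto_def successor_code_def state_code_def using reach.step by blast
qed

lemma ach_main_step:
  assumes inv: "main_inv p R M" and pos: "R 6 > 0"
  shows "ach main_body R M (sweep_time + 7) (\<lambda>R' M'. (\<exists>p. main_inv p R' M') \<and> R' 6 < R 6)"
proof -
  define A where "A = 5 * lam + 3 + p * num_states"
  have p: "p < n" and R: "R 2 = lam" "R 3 = 1" "R 4 = num_states" "R 5 = 5 * lam + 2"
     "R 6 = n - p" "R 7 = p" "R 22 = 0" "R 10 = A" and tab: "tables M"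
     and marks: "\<And>y. M (A + y) > 0 \<longleftrightarrow> state_code (Suc p) y"
    using inv pos unfolding main_inv_def A_def by auto
  define R1 where "R1 = R(6 := n - p - 1, 7 := Suc p, 0 := 0, 8 := num_states, 9 := 0)"
  have start: "blk [Sub 6 6 3, Add 7 7 3, Const 0 0, Add 8 4 22, Const 9 0] R M (\<lambda>R' M'. R' = R1 \<and> M' = M)"
    using R by (simp add: R1_def)
  have less: "s < num_states" if "state_code (Suc p) s" for s
    using that reach_code_less[of "Suc p"] p by (auto simp: state_code_def)
  \<comment> \<open>\<open>marks\<close> covers all addresses from \<open>A\<close> on, and the
    codes at this position stay below \<open>num_states\<close>; hence the row to be written is
    still blank.\<close>
  have fresh: "M (A + num_states + y) = 0" for y
    using marks[of "num_states + y"] less[of "num_states + y"] by (auto simp: add.assoc)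
  have loop: "ach (Loop 8 sweep_body) R1 M (sweep_time + 2) (\<lambda>R' M'. sweep_inv (Suc p) A R1 M num_states R' M')"
  proof (rule ach_Loop[where f = "\<lambda>R'. R' 8" and Tb = "layer_time + 19" and
      I = "\<lambda>R' M'. \<exists>s. sweep_inv (Suc p) A R1 M s R' M'"])
    have "sweep_inv (Suc p) A R1 M 0 R1 M"
      unfolding sweep_inv_def using R fresh
      by (auto simp: R1_def accepting_upto_def successors_upto_def)
    then show "\<exists>s. sweep_inv (Suc p) A R1 M s R1 M" by blast
    show "R1 8 * (layer_time + 19 + 2) + 2 \<le> sweep_time + 2" by (simp add: R1_def)
  next
    fix R' M' assume "\<exists>s. sweep_inv (Suc p) A R1 M s R' M'" "R' 8 > 0"
    then obtain s where "sweep_inv (Suc p) A R1 M s R' M'" by blast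
    then show "ach sweep_body R' M' (layer_time + 19)
        (\<lambda>R'' M''. (\<exists>s. sweep_inv (Suc p) A R1 M s R'' M'') \<and> R'' 8 < R' 8)"
      by (rule ach_sweep_step) (use \<open>R' 8 > 0\<close> p tab marks R in \<open>simp_all add: A_def R1_def\<close>)
  next
    fix R' M' assume "\<exists>s. sweep_inv (Suc p) A R1 M s R' M'" "R' 8 = 0"
    then show "sweep_inv (Suc p) A R1 M num_states R' M'" unfolding sweep_inv_def by auto
  qed
  have "ach main_body R M (sweep_time + 7) (\<lambda>R' M'. sweep_inv (Suc p) A R1 M num_states R' M')"
    using ach_Seq_det[OF ach_Block[OF start order_refl] loop, of "sweep_time + 7"]
    unfolding main_body_def by simp
  then show ?thesis
  proof (rule ach_mono)
    fix R' M' assume fin: "sweep_inv (Suc p) A R1 M num_states R' M'"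
    have A': "5 * lam + 3 + Suc p * num_states = A + num_states" by (simp add: A_def)
    have frame: "R' j = R1 j" if "j \<in> {1..7}" for j using fin that unfolding sweep_inv_def by blast
    have "tables M'"
      by (rule tables_cong[OF tab]) (use fin in \<open>auto simp: sweep_inv_def A_def\<close>)
    moreover have "accepting_upto n num_states \<longleftrightarrow> (\<exists>b c. reach n b c \<and> accepting n b c)"
      unfolding accepting_upto_def using reach_code_less by blast
    moreover have "M' (A + num_states + y) > 0 \<longleftrightarrow> state_code (Suc (Suc p)) y" for y
      using fin state_code_Suc[of "Suc p" y] p unfolding sweep_inv_def by auto
    moreover have "R' 2 = lam" "R' 3 = 1" "R' 4 = num_states" "R' 5 = 5 * lam + 2"
      "R' 6 = n - Suc p" "R' 7 = Suc p" using frame R by (simp_all add: R1_def)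
    moreover have "R' 22 = 0" "R' 10 = A + num_states"
      "R' 0 = (if accepting_upto (Suc p) num_states then 1 else 0)"
      using fin unfolding sweep_inv_def by blast+
    ultimately have "main_inv (Suc p) R' M'"
      unfolding main_inv_def A' using p by auto
    then show "(\<exists>p. main_inv p R' M') \<and> R' 6 < R 6"
      using R p \<open>R' 6 = n - Suc p\<close> by auto
  qed simp
qed

section \<open>Preparing the memory and running the whole program\<close>

definition instance_memory :: "(nat \<Rightarrow> nat) \<Rightarrow> bool" where
  "instance_memory M \<longleftrightarrow> M 0 = lam \<and> M 1 = n \<and>
     (\<forall>i\<in>{1..lam}. M (3 * i - 1) = N i \<and> M (3 * i) = L i \<and> M (3 * i + 1) = U i) \<and>
     (\<forall>j\<ge>3 * lam + 2. M j = 0)"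

text \<open>Each power is the sum of \<open>n\<close> copies of the preceding one. The cells behind
  the instance are 0 and thus form an empty table of marks.\<close>

lemma ach_prepare:
  assumes "instance_memory M"
  shows "ach prepare (\<lambda>_. 0) M (2 * lam * (4 * n + 10) + 15) (\<lambda>R' M'. main_inv 0 R' M')"
proof -
  define D where "D = 3 * lam + 2"
  define powers where "powers k j = (if D \<le> j \<and> j \<le> D + k then n ^ (j - D) else M j)" for k j
  have M01: "M 0 = lam" "M (Suc 0) = n" and free: "\<And>j. j \<ge> D \<Longrightarrow> M j = 0"
    using assms unfolding instance_memory_def D_def by auto
  define inv :: "nat \<Rightarrow> (nat \<Rightarrow> nat) \<Rightarrow> (nat \<Rightarrow> nat) \<Rightarrow> bool" where "inv k R M' \<longleftrightarrow> k \<le> 2 * lam \<and> R 0 = 0 \<and> R 1 = n \<and> R 2 = lam \<and> R 3 = 1 \<and> R 22 = 0 \<and>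
     R 4 = n ^ k \<and> R 5 = D + k \<and> R 18 = 2 * lam - k \<and> M' = powers k" for k R M'
  let ?body = "Seq (Block [Add 21 1 22, Const 17 0]) (Seq (add_multiple 17 4 21)
        (Block [Add 4 17 22, Add 5 5 3, Store 5 4, Sub 18 18 3]))"
  have first: "blk [Load 2 0, Const 3 1, Load 1 3, Add 18 2 2, Add 5 18 2, Add 5 5 3, Add 5 5 3, Const 4 1, Store 5 3]
      (\<lambda>_. 0) M (inv 0)"
    using M01 by (auto simp: inv_def powers_def D_def fun_eq_iff)
  have step: "ach ?body R M' (4 * n + 8) (\<lambda>R' M''. (\<exists>k. inv k R' M'') \<and> R' 18 < R 18)"
    if I: "inv k R M'" and pos: "R 18 > 0" for k R M'
  proof -
    have k: "k < 2 * lam" using I pos by (auto simp: inv_def)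
    define R1 where "R1 = R(21 := n, 17 := 0)"
    define R2 where "R2 = R1(17 := n * n ^ k, 21 := 0)"
    have c1: "ach (Block [Add 21 1 22, Const 17 0]) R M' 2 (\<lambda>R' M''. R' = R1 \<and> M'' = M')"
      by (rule ach_Block) (use I in \<open>simp_all add: inv_def R1_def\<close>)
    have c2: "ach (add_multiple 17 4 21) R1 M' (4 * n + 2) (\<lambda>R' M''. R' = R2 \<and> M'' = M')"
      by (rule ach_mono[OF ach_add_multiple]) (use I in \<open>simp_all add: inv_def R1_def R2_def\<close>)
    define R3 where "R3 = R2(4 := n ^ Suc k, 5 := D + Suc k, 18 := 2 * lam - Suc k)"
    define M3 where "M3 = M'(D + Suc k := n ^ Suc k)"
    have "M3 = powers (Suc k)"
      using I by (auto simp: M3_def inv_def powers_def fun_eq_iff le_Suc_eq)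
    then have "inv (Suc k) R3 M3"
      using I k by (simp add: inv_def R1_def R2_def R3_def)
    moreover have "R3 18 < R 18" using I k by (simp add: inv_def R3_def)
    moreover have "blk [Add 4 17 22, Add 5 5 3, Store 5 4, Sub 18 18 3] R2 M' (\<lambda>R' M''. R' = R3 \<and> M'' = M3)"
      using I by (simp add: inv_def R1_def R2_def R3_def M3_def)
    ultimately have c3: "ach (Block [Add 4 17 22, Add 5 5 3, Store 5 4, Sub 18 18 3]) R2 M' 4
        (\<lambda>R' M''. (\<exists>k. inv k R' M'') \<and> R' 18 < R 18)"
      by (intro ach_mono[OF ach_Block[OF _ order_refl]]) auto
    show ?thesis
      by (rule ach_Seq_det[OF c1 ach_Seq_det[OF c2 c3 order_refl]]) simp
  qed
  have loop: "ach (Loop 18 ?body) R M' (2 * lam * (4 * n + 10) + 2) (inv (2 * lam))" if "inv 0 R M'" for R M'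
  proof (rule ach_Loop[where f = "\<lambda>R. R 18" and Tb = "4 * n + 8" and I = "\<lambda>R' M'. \<exists>k. inv k R' M'"])
    show "\<exists>k. inv k R M'" using that by blast
    show "R 18 * (4 * n + 8 + 2) + 2 \<le> 2 * lam * (4 * n + 10) + 2" using that by (simp add: inv_def)
  next
    fix R M' assume "\<exists>k. inv k R M'" "0 < R 18"
    then show "ach ?body R M' (4 * n + 8) (\<lambda>R' M''. (\<exists>k. inv k R' M'') \<and> R' 18 < R 18)"
      using step by blast
  next
    fix R M' assume "\<exists>k. inv k R M'" "R 18 = 0"
    then show "inv (2 * lam) R M'" by (auto simp: inv_def)
  qed
  have last: "ach (Block [Add 10 5 3, Store 10 3, Const 7 0, Add 6 1 22]) R M' 4 (main_inv 0)"
    if I: "inv (2 * lam) R M'" for R M'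
  proof (rule ach_Block)
    define A where "A = Suc (D + 2 * lam)"
    have A: "5 * lam + 3 + 0 * num_states = A" by (simp add: A_def D_def)
    define R1 where "R1 = R(10 := A, 7 := 0, 6 := n)"
    define M1 where "M1 = M'(A := 1)"
    have "state_code (Suc 0) y \<longleftrightarrow> y = 0" for y
    proof -
      have "code (\<lambda>_. 0) (\<lambda>_. 0) = 0" by (simp add: tail_code_def)
      moreover have "b = (\<lambda>_. 0) \<and> c = (\<lambda>_. 0)" if "reach (Suc 0) b c" for b c
        using reach_bounds[OF that] by auto
      ultimately show ?thesis using init unfolding state_code_def by (metis One_nat_def)
    qed
    moreover have "M1 (A + y) > 0 \<longleftrightarrow> y = 0" for y
      using I free[of "A + y"] by (auto simp: inv_def M1_def powers_def A_def D_def)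
    moreover have "tables M1"
      using I assms unfolding tables_def instance_memory_def
      by (auto simp: inv_def M1_def powers_def A_def D_def)
    moreover have "\<not> reach 0 b c" for b c using reach_bounds[of 0] by auto
    ultimately have "main_inv 0 R1 M1"
      using I unfolding main_inv_def A by (auto simp: inv_def R1_def D_def)
    then show "blk [Add 10 5 3, Store 10 3, Const 7 0, Add 6 1 22] R M' (main_inv 0)"
      using I by (simp add: inv_def R1_def M1_def A_def)
  qed simp
  have rest: "ach (Seq (Loop 18 ?body) (Block [Add 10 5 3, Store 10 3, Const 7 0, Add 6 1 22])) R M'
      (2 * lam * (4 * n + 10) + 6) (main_inv 0)" if "inv 0 R M'" for R M'
    by (rule ach_Seq[OF ach_mono[OF loop[OF that] order_refl last]]) simp_all
  have "ach (Seq (Block [Load 2 0, Const 3 1, Load 1 3, Add 18 2 2, Add 5 18 2, Add 5 5 3, Add 5 5 3,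
        Const 4 1, Store 5 3]) (Seq (Loop 18 ?body) (Block [Add 10 5 3, Store 10 3, Const 7 0, Add 6 1 22])))
      (\<lambda>_. 0) M (2 * lam * (4 * n + 10) + 15) (main_inv 0)"
    by (rule ach_Seq[OF ach_mono[OF ach_Block[OF first order_refl] order_refl rest]]) (simp_all add: algebra_simps)
  then show ?thesis by (simp add: prepare_def)
qed

abbreviation program_time :: nat where
  "program_time \<equiv> 2 * lam * (4 * n + 10) + 17 + n * (sweep_time + 9)"

lemma ach_clt_program:
  assumes "instance_memory M"
  shows "ach clt_program (\<lambda>_. 0) M program_time
    (\<lambda>R M. R 0 = (if \<exists>b c. reach n b c \<and> accepting n b c then 1 else 0))"
proof -
  have loop: "ach (Loop 6 main_body) R M (n * (sweep_time + 9) + 2)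
    (\<lambda>R M. R 0 = (if \<exists>b c. reach n b c \<and> accepting n b c then 1 else 0))" if "main_inv 0 R M" for R M
  proof (rule ach_Loop[where f = "\<lambda>R. R 6" and Tb = "sweep_time + 7" and I = "\<lambda>R M. \<exists>p. main_inv p R M"])
    show "\<exists>p. main_inv p R M" using that by blast
    show "R 6 * (sweep_time + 7 + 2) + 2 \<le> n * (sweep_time + 9) + 2" using that by (simp add: main_inv_def)
  next
    fix R M assume "\<exists>p. main_inv p R M" "0 < R 6"
    then show "ach main_body R M (sweep_time + 7) (\<lambda>R' M'. (\<exists>p. main_inv p R' M') \<and> R' 6 < R 6)"
      using ach_main_step by blast
  next
    fix R M assume "\<exists>p. main_inv p R M" "R 6 = 0"
    then show "R 0 = (if \<exists>b c. reach n b c \<and> accepting n b c then 1 else 0)"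
      unfolding main_inv_def by auto
  qed
  show ?thesis
    unfolding clt_program_def
    by (rule ach_Seq[OF ach_mono[OF ach_prepare[OF assms] order_refl loop]]) simp_all
qed

end

section \<open>The running time\<close>

lemma triples_nth:
  fixes f g h :: "nat \<Rightarrow> nat"
  defines "triples \<equiv> \<lambda>m. concat (map (\<lambda>i. [f i, g i, h i]) [1..<Suc m])"
  shows "length (triples m) = 3 * m"
    and "i < m \<Longrightarrow> triples m ! (3 * i) = f (Suc i) \<and> triples m ! (3 * i + 1) = g (Suc i) \<and>
      triples m ! (3 * i + 2) = h (Suc i)"
proof -
  have Suc: "triples (Suc m) = triples m @ [f (Suc m), g (Suc m), h (Suc m)]" for m
    by (simp add: triples_def)
  show len: "length (triples m) = 3 * m" for m
    by (induction m) (simp_all add: Suc, simp add: triples_def)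
  show "i < m \<Longrightarrow> triples m ! (3 * i) = f (Suc i) \<and> triples m ! (3 * i + 1) = g (Suc i) \<and>
      triples m ! (3 * i + 2) = h (Suc i)"
  proof (induction m)
    case (Suc m)
    show ?case
    proof (cases "i = m")
      case True
      then show ?thesis unfolding \<open>triples (Suc m) = _\<close> by (simp add: nth_append len)
    next
      case False
      then show ?thesis using Suc unfolding \<open>triples (Suc m) = _\<close> by (simp add: nth_append len)
    qed
  qed simp
qed

text \<open>The two header cells shift the triples by two, and addresses past the end of the list
  read as 0.\<close>

lemma instance_memory_encode:
  "layers.instance_memory (layer_size I 0) (num_layers I) (layer_size I) (lower_cap I) (upper_cap I)
     (mem (init_config (encode I)))"
proof -
  define T where
    "T = concat (map (\<lambda>i. [layer_size I i, lower_cap I i, upper_cap I i]) [1..<Suc (num_layers I)])"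
  have enc: "encode I = num_layers I # layer_size I 0 # T" by (simp add: encode_def T_def)
  have len: "length T = 3 * num_layers I" unfolding T_def by (rule triples_nth(1))
  have nth: "T ! (3 * i) = layer_size I (Suc i)" "T ! (3 * i + 1) = lower_cap I (Suc i)"
    "T ! (3 * i + 2) = upper_cap I (Suc i)" if "i < num_layers I" for i
    unfolding T_def using triples_nth(2)[OF that] by blast+
  have mem: "mem (init_config (encode I)) (Suc (Suc j)) = (if j < length T then T ! j else 0)" for j
    by (simp add: init_config_def enc)
  show ?thesis
    unfolding layers.instance_memory_def
  proof (intro conjI ballI allI impI)
    fix i assume "i \<in> {1..num_layers I}"
    then obtain k where k: "i = Suc k" "k < num_layers I" by (cases i) auto
    have "3 * i - 1 = Suc (Suc (3 * k))" "3 * i = Suc (Suc (3 * k + 1))" "3 * i + 1 = Suc (Suc (3 * k + 2))"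
      using k by simp_all
    then show "mem (init_config (encode I)) (3 * i - 1) = layer_size I i"
      "mem (init_config (encode I)) (3 * i) = lower_cap I i"
      "mem (init_config (encode I)) (3 * i + 1) = upper_cap I i"
      using nth[OF k(2)] k len by (simp_all only: mem) simp_all
  next
    fix j assume "3 * num_layers I + 2 \<le> j"
    then obtain j' where "j = Suc (Suc j')" "j' \<ge> length T"
      unfolding len by (metis add_2_eq_Suc' le_Suc_ex add.assoc add.commute le_add1)
    then show "mem (init_config (encode I)) j = 0" by (simp only: mem) simp
  qed (simp_all add: init_config_def enc)
qed

lemma clt_program_correct:
  fixes I
  defines "n \<equiv> layer_size I 0" and "lam \<equiv> num_layers I"
  shows "halts (compile 0 clt_program) (encode I)"
    and "running_time (compile 0 clt_program) (encode I) \<le> layers.program_time n lam"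
    and "ram_output (compile 0 clt_program) (encode I) = (if constrained_layer_tree I then 1 else 0)"
proof -
  interpret layers n lam "layer_size I" "lower_cap I" "upper_cap I" .
  have "constrained_layer_tree I \<longleftrightarrow> (\<exists>b c. reach n b c \<and> accepting n b c)"
    unfolding constrained_layer_tree_iff n_def[symmetric] lam_def[symmetric] by (rule layering_iff_accepting)
  then have run: "ach clt_program (\<lambda>_. 0) (mem (init_config (encode I))) program_time
      (\<lambda>R M. R 0 = (if constrained_layer_tree I then 1 else 0))"
    using ach_clt_program[OF instance_memory_encode[of I, folded n_def lam_def]] by simp
  from ach_program[OF run]
  show "halts (compile 0 clt_program) (encode I)"
    "running_time (compile 0 clt_program) (encode I) \<le> program_time"
    "ram_output (compile 0 clt_program) (encode I) = (if constrained_layer_tree I then 1 else 0)" .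
qed

text \<open>All lower terms are measured by \<open>m = lam * n\<close>, with
  \<open>2 * lam \<le> m\<close>, \<open>n \<le> m\<close> and \<open>2 \<le> m\<close>. The time
  for one state contributes 16 + 21 + 11 = 48; the loop over positions adds 9, the table of powers
  18, and the constant 17 at most 9, which makes 84.\<close>

lemma program_time_le:
  assumes "n \<ge> 2" "lam \<ge> 1"
  shows "layers.program_time n lam \<le> 84 * (n ^ (2 * lam + 2) * lam)"
proof -
  define m where "m = lam * n"
  have m: "2 * lam \<le> m" "n \<le> m"
    using mult_le_mono2[OF assms(1), of lam] mult_le_mono1[OF assms(2), of n]
    unfolding m_def by (simp_all add: mult.commute)
  moreover from this have "2 \<le> m" using assms by linarith
  ultimately have m: "2 * lam \<le> m" "n \<le> m" "2 \<le> m" .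
  have "lam * (16 * n + 42) + 21 = 16 * m + 42 * lam + 21" by (simp add: m_def algebra_simps)
  also have "\<dots> \<le> 48 * m" using m by simp
  finally have "n ^ (2 * lam) * (lam * (16 * n + 42) + 21) \<le> n ^ (2 * lam) * (48 * m)"
    by (rule mult_le_mono2)
  then have "n * (n ^ (2 * lam) * (lam * (16 * n + 42) + 21) + 9) \<le> n * (n ^ (2 * lam) * (48 * m) + 9)"
    by (intro mult_le_mono2) simp
  also have "\<dots> = 48 * (n ^ (2 * lam + 2) * lam) + 9 * n" by (simp add: m_def algebra_simps)
  finally have 1: "n * (n ^ (2 * lam) * (lam * (16 * n + 42) + 21) + 9)
      \<le> 48 * (n ^ (2 * lam + 2) * lam) + 9 * n" .
  have 2: "2 * lam * (4 * n + 10) = 8 * m + 20 * lam" by (simp add: m_def algebra_simps)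
  have "n ^ 1 \<le> n ^ (2 * lam + 2)" using assms by (intro power_increasing) auto
  then have "m \<le> n ^ (2 * lam + 2) * lam" unfolding m_def by (simp add: mult.commute)
  then show ?thesis using 1 2 m by linarith
qed

text \<open>The principal filter makes the bound uniform over the instances in the set, with one
  constant. Outside this set the bounding function is 0, although the program is correct there as
  well.\<close>

theorem theorem3p6:
  shows "\<exists>P. solves_clt P \<and>
    (\<lambda>I :: clt_instance. real (running_time P (encode I)))
      \<in> O[principal {I. layer_size I 0 \<ge> 2 \<and> num_layers I \<ge> 1}](\<lambda>I.
          real (layer_size I 0) ^ (2 * num_layers I + 2)
            * real (num_layers I) ^ 2 * log 2 (real (layer_size I 0)))"
proof (intro exI conjI)
  show "solves_clt (compile 0 clt_program)"
    unfolding solves_clt_def using clt_program_correct by blast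
  have bound: "real (running_time (compile 0 clt_program) (encode I)) \<le>
      84 * (real n ^ (2 * lam + 2) * real lam ^ 2 * log 2 (real n))"
    if n: "n = layer_size I 0" "n \<ge> 2" and lam: "lam = num_layers I" "lam \<ge> 1" for I n lam
  proof -
    have "running_time (compile 0 clt_program) (encode I) \<le> 84 * (n ^ (2 * lam + 2) * lam)"
      using clt_program_correct(2)[of I] program_time_le[OF n(2) lam(2)] unfolding n(1) lam(1)
      by (rule order_trans)
    then have "real (running_time (compile 0 clt_program) (encode I)) \<le> 84 * (real n ^ (2 * lam + 2) * real lam)"
      by (simp flip: of_nat_power of_nat_mult add: of_nat_le_iff)
    \<comment> \<open>The time obtained so far lacks the factor \<open>lam * log 2 n\<close>, which
      is at least 1 for these instances.\<close>
    also have "real lam \<le> real lam ^ 2 * log 2 (real n)"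
    proof -
      have "1 \<le> log 2 (real n)" using n(2) by simp
      moreover have "real lam \<le> real lam ^ 2" using lam(2) by (simp add: power2_eq_square)
      ultimately show ?thesis using mult_mono[of "real lam" "real lam ^ 2" 1] by simp
    qed
    finally show ?thesis by (simp add: mult.assoc mult_left_mono)
  qed
  show "(\<lambda>I. real (running_time (compile 0 clt_program) (encode I)))
      \<in> O[principal {I. layer_size I 0 \<ge> 2 \<and> num_layers I \<ge> 1}](\<lambda>I.
          real (layer_size I 0) ^ (2 * num_layers I + 2)
            * real (num_layers I) ^ 2 * log 2 (real (layer_size I 0)))"
    by (rule bigoI[of _ 84], simp only: eventually_principal)
      (use bound in \<open>auto simp: abs_mult\<close>)
qed

end
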